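(* Let $n$ and $k$ be integers with $1<k\le n$. Consider the maximal simplices of the noncrossing partition link $\mathrm{Link}(\mathrm{NC}_{n+1})$ whose labels are parking functions of length $n$ for which $k$ is the largest undesired parking space, i.e. the parking functions in $\mathrm{PF}_{n,k}$. These simplices, together with all of their faces, form a contractible subcomplex of $\mathrm{Link}(\mathrm{NC}_{n+1})$.
   Context: Let $P$ be a convex $(n+1)$-gon with vertices labeled $1,\dots,n+1$ in clockwise order. A \emph{noncrossing partition} of $P$ is a partition of its vertex set such that the convex hulls of the blocks are pairwise disjoint. Ordered by refinement ($\pi\le\pi'$ if every block of $\pi$ is contained in a block of $\pi'$), the noncrossing partitions form a bounded graded lattice $\mathrm{NC}_{n+1}$. The \emph{noncrossing partition link} $\mathrm{Link}(\mathrm{NC}_{n+1})$ is the order complex of $\mathrm{NC}_{n+1}$ with its minimum and maximum elements removed; its maximal simplices correspond to the maximal chains of $\mathrm{NC}_{n+1}$. Each noncrossing partition $\pi$ is identified with a permutation of $\{1,\dots,n+1\}$: each vertex $v$ is sent to the next vertex, in clockwise order, of the convex hull of the block of $\pi$ containing $v$. The maximum element corresponds to the cycle $c=(1,2,\dots,n+1)$. Permutations are multiplied as functions (right factor applied first). For a covering relation $\pi<\pi'$, the permutation $\pi'\pi^{-1}$ is a transposition. An $n$-tuple $(a_1,\dots,a_n)$ of positive integers is a \emph{parking function} of length $n$ if, after sorting its entries into weakly increasing order, the $i$-th entry is at most $i$ for each $i$. An integer $k\in\{1,\dots,n\}$ is an \emph{undesired parking space} for $(a_1,\dots,a_n)$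 if $k$ does not appear among the entries. $\mathrm{PF}_{n,k}$ denotes the set of parking functions of length $n$ for which $k$ is the largest undesired parking space (so $k$ does not appear and each of $k+1,\dots,n$ does). For a maximal chain $\pi_0<\pi_1<\dots<\pi_n$ of $\mathrm{NC}_{n+1}$, put $t_i=\pi_i\pi_{i-1}^{-1}$, so that $c=t_n\cdots t_1$, and let $a_i$ be the smaller of the two numbers exchanged by $t_i$. Stanley proved that the map sending the chain to $(a_1,\dots,a_n)$ is a bijection from the maximal chains of $\mathrm{NC}_{n+1}$ to the parking functions of length $n$. The parking function of a maximal chain is the label of the corresponding maximal simplex of $\mathrm{Link}(\mathrm{NC}_{n+1})$. *)

theory Defs
  imports "HOL-Analysis.Analysis" "HOL-Library.Disjoint_Sets"
begin

section \<open>Convex polygons and noncrossing partitions\<close>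

definition clockwise :: "real^2 \<Rightarrow> real^2 \<Rightarrow> real^2 \<Rightarrow> bool" where
  "clockwise a b c \<longleftrightarrow> (b - a) $ 1 * (c - a) $ 2 - (b - a) $ 2 * (c - a) $ 1 < 0"

text \<open>The points \<open>P 1, \<dots>, P m\<close> are the vertices of a (strictly) convex \<open>m\<close>-gon, listed in clockwise
  order; the values of \<open>P\<close> at other indices are irrelevant.\<close>

definition convex_polygon :: "nat \<Rightarrow> (nat \<Rightarrow> real^2) \<Rightarrow> bool" where
  "convex_polygon m P \<longleftrightarrow> 3 \<le> m \<and>
     (\<forall>i j l. 1 \<le> i \<and> i < j \<and> j < l \<and> l \<le> m \<longrightarrow> clockwise (P i) (P j) (P l))"

text \<open>Vertices are represented by their labels. The order on noncrossing partitions is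
  \<^const>\<open>refines\<close>, restricted to \<open>NC m P\<close>.\<close>

definition NC :: "nat \<Rightarrow> (nat \<Rightarrow> real^2) \<Rightarrow> nat set set set" where
  "NC m P = {\<pi>. partition_on {1..m} \<pi> \<and>
     (\<forall>A\<in>\<pi>. \<forall>B\<in>\<pi>. A \<noteq> B \<longrightarrow> convex hull (P ` A) \<inter> convex hull (P ` B) = {})}"

definition NC_min :: "nat \<Rightarrow> nat set set" where
  "NC_min m = (\<lambda>v. {v}) ` {1..m}"

definition NC_max :: "nat \<Rightarrow> nat set set" where
  "NC_max m = {{1..m}}"


section \<open>Simplicial complexes\<close>

text \<open>An abstract simplicial complex is given by its set of nonempty simplices.\<close>

definition abstract_complex :: "'v set set \<Rightarrow> bool" where
  "abstract_complex K \<longleftrightarrow> (\<forall>\<sigma>\<in>K. finite \<sigma> \<and> \<sigma> \<noteq> {} \<and> (\<forall>\<tau>. \<tau> \<noteq> {} \<and> \<tau> \<subseteq> \<sigma> \<longrightarrow> \<tau> \<in> K))"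

definition subcomplex :: "'v set set \<Rightarrow> 'v set set \<Rightarrow> bool" where
  "subcomplex L K \<longleftrightarrow> abstract_complex L \<and> L \<subseteq> K"

definition maximal_simplices :: "'v set set \<Rightarrow> 'v set set" where
  "maximal_simplices K = {\<sigma>\<in>K. \<forall>\<tau>\<in>K. \<sigma> \<subseteq> \<tau> \<longrightarrow> \<tau> = \<sigma>}"

definition with_faces :: "'v set set \<Rightarrow> 'v set set" where
  "with_faces F = {\<tau>. \<tau> \<noteq> {} \<and> (\<exists>\<sigma>\<in>F. \<tau> \<subseteq> \<sigma>)}"

definition order_complex :: "'v set \<Rightarrow> ('v \<Rightarrow> 'v \<Rightarrow> bool) \<Rightarrow> 'v set set" where
  "order_complex V le = {\<sigma>. finite \<sigma> \<and> \<sigma> \<noteq> {} \<and> \<sigma> \<subseteq> V \<and> (\<forall>x\<in>\<sigma>. \<forall>y\<in>\<sigma>. le x y \<or> le y x)}"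

text \<open>Points are given by barycentric coordinates, extended by zero to all of \<open>'v\<close>. On a complex
  with finitely many simplices, the topology of pointwise convergence used here is the usual
  topology of the realization (for infinite complexes it need not be).\<close>

definition geometric_realization :: "'v set set \<Rightarrow> ('v \<Rightarrow> real) topology" where
  "geometric_realization K = subtopology (powertop_real UNIV)
     {x. (\<forall>v. 0 \<le> x v) \<and> {v. x v \<noteq> 0} \<in> K \<and> (\<Sum>v | x v \<noteq> 0. x v) = 1}"

text \<open>\<^const>\<open>contractible_space\<close> holds of the empty space, which is excluded here.\<close>

definition contractible_complex :: "'v set set \<Rightarrow> bool" where
  "contractible_complex K \<longleftrightarrow>
     topspace (geometric_realization K) \<noteq> {} \<and> contractible_space (geometric_realization K)"

definition NC_link :: "nat \<Rightarrow> (nat \<Rightarrow> real^2) \<Rightarrow> nat set set set set" where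
  "NC_link m P = order_complex (NC m P - {NC_min m, NC_max m}) (refines {1..m})"


section \<open>Permutations and labels\<close>

text \<open>Since labels increase clockwise, the next vertex of a block after \<open>v\<close> is the one with the next
  larger label, wrapping around to the smallest label.\<close>

definition next_vertex :: "nat set \<Rightarrow> nat \<Rightarrow> nat" where
  "next_vertex B v = (if \<exists>w\<in>B. v < w then Min {w\<in>B. v < w} else Min B)"

definition NC_perm :: "nat set set \<Rightarrow> nat \<Rightarrow> nat" where
  "NC_perm \<pi> v = (if v \<in> \<Union>\<pi> then next_vertex (THE B. B \<in> \<pi> \<and> v \<in> B) v else v)"

text \<open>For a transposition \<open>t\<close> this is the smaller of the two numbers it exchanges.\<close>

definition smaller_moved :: "(nat \<Rightarrow> nat) \<Rightarrow> nat" where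
  "smaller_moved t = Min {v. t v \<noteq> v}"

text \<open>A chain \<open>\<pi>\<^sub>0 < \<dots> < \<pi>\<^sub>n\<close> is given as the list of its elements in increasing order.\<close>

definition chain_label :: "nat set set list \<Rightarrow> nat list" where
  "chain_label \<pi>s =
     map (\<lambda>i. smaller_moved (NC_perm (\<pi>s ! i) \<circ> inv (NC_perm (\<pi>s ! (i - 1))))) [1..<length \<pi>s]"

definition increasing_list :: "nat \<Rightarrow> nat set set set \<Rightarrow> nat set set list" where
  "increasing_list m C =
     (THE \<pi>s. set \<pi>s = C \<and> sorted_wrt (\<lambda>\<pi> \<pi>'. refines {1..m} \<pi> \<pi>' \<and> \<pi> \<noteq> \<pi>') \<pi>s)"

definition simplex_label :: "nat \<Rightarrow> nat set set set \<Rightarrow> nat list" where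
  "simplex_label m \<sigma> = chain_label (increasing_list m (\<sigma> \<union> {NC_min m, NC_max m}))"


section \<open>Parking functions\<close>

text \<open>List indices start at 0, whence the \<open>i + 1\<close>.\<close>

definition parking_function :: "nat \<Rightarrow> nat list \<Rightarrow> bool" where
  "parking_function n as \<longleftrightarrow>
     length as = n \<and> (\<forall>a\<in>set as. 0 < a) \<and> (\<forall>i<n. sort as ! i \<le> i + 1)"

definition undesired :: "nat \<Rightarrow> nat list \<Rightarrow> nat set" where
  "undesired n as = {1..n} - set as"

definition PF :: "nat \<Rightarrow> nat \<Rightarrow> nat list set" where
  "PF n k = {as. parking_function n as \<and> k \<in> undesired n as \<and> (\<forall>j\<in>undesired n as. j \<le> k)}"

end

theory Submission
  imports Defs
begin

text \<open>The complex is in general not the order complex of a subposet of the noncrossing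
  partitions under refinement: two of its vertices can be comparable although every chain through
  both misses \<open>mid\<close>. This forces the modified order \<open>le\<close>, whose
  transitivity has to be proved. One target for all meets does not suffice. A partition
  \<open>x\<close> with block \<open>{k}\<close> may join \<open>m\<close> to a vertex below
  \<open>k\<close>; then it does not refine the partition into \<open>{1..k}\<close> and singletons,
  and meets with that partition need not stay above \<open>x\<close>. Hence the target depends on
  \<open>x\<close>. Removing from the top ensures that whatever is left above \<open>x\<close> does
  not have \<open>{k}\<close> as a block; among such partitions \<open>le\<close> is plain
  refinement, so meets for refinement are meets for \<open>le\<close>. A meet of \<open>y\<close>
  with a target lands in \<open>mid\<close> as soon as the blocks of \<open>k\<close> in both share
  a second vertex. Each target is chosen so that its block of \<open>k\<close> contains the block of
  \<open>k\<close> of every relevant member of \<open>mid\<close>, which supplies this vertex. For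
  \<open>k = 1\<close> no block with maximum \<open>k\<close> has a second vertex, and
  \<open>mid\<close> would be empty.\<close>

text \<open>Merging two blocks of a noncrossing partition produces as label the minimum of the block with the
  smaller maximum. Hence a maximal chain is labelled by an element of \<open>PF n k\<close> iff each of the vertices
  \<open>k + 1, \<dots>, n\<close> is a singleton as long as it is the maximum of its block (\<open>tame\<close>), and \<open>k\<close> is at some
  stage the maximum of a block with at least two elements (\<open>mid\<close>). The faces of these chains are
  the chains of a poset of tame partitions. In this poset the partitions having \<open>{k}\<close> as a block are removed
  from the top downwards; the elements above such an \<open>x\<close> are contracted by taking meets with a
  two-block partition that depends on \<open>x\<close>. The remaining elements are contracted by taking meets with the
  partition into \<open>{1..k}\<close> and singletons. Each contraction is a sequence of collapses of open stars whose
  links are cones.\<close>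

section \<open>Realizations and collapses\<close>

lemma abstract_complex_finite: "abstract_complex K \<Longrightarrow> \<sigma> \<in> K \<Longrightarrow> finite \<sigma>"
  by (auto simp: abstract_complex_def)

lemma abstract_complex_face:
  "abstract_complex K \<Longrightarrow> \<sigma> \<in> K \<Longrightarrow> \<tau> \<noteq> {} \<Longrightarrow> \<tau> \<subseteq> \<sigma> \<Longrightarrow> \<tau> \<in> K"
  unfolding abstract_complex_def by blast

lemma topspace_realization:
  "topspace (geometric_realization K) =
    {x. (\<forall>v. 0 \<le> x v) \<and> {v. x v \<noteq> 0} \<in> K \<and> (\<Sum>v | x v \<noteq> 0. x v) = 1}"
  by (simp add: geometric_realization_def)

lemma realization_sum:
  assumes "abstract_complex K" "x \<in> topspace (geometric_realization K)" "finite \<rho>" "{v. x v \<noteq> 0} \<subseteq> \<rho>"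
  shows "sum x \<rho> = 1"
proof -
  have "sum x \<rho> = (\<Sum>v | x v \<noteq> 0. x v)"
    using assms(3,4) by (intro sum.mono_neutral_right) auto
  then show ?thesis using assms(2) by (simp add: topspace_realization)
qed

lemma realization_memI:
  assumes "abstract_complex K" "\<rho> \<in> K" "{v. x v \<noteq> 0} \<subseteq> \<rho>" "\<And>v. 0 \<le> x v" "sum x \<rho> = 1"
  shows "x \<in> topspace (geometric_realization K)"
proof -
  have fin: "finite \<rho>" using assms abstract_complex_finite by blast
  have "sum x \<rho> = (\<Sum>v | x v \<noteq> 0. x v)"
    using assms(3) fin by (intro sum.mono_neutral_right) auto
  then have s: "(\<Sum>v | x v \<noteq> 0. x v) = 1" using assms(5) by simp
  then have "{v. x v \<noteq> 0} \<noteq> {}" by (metis sum.empty zero_neq_one)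
  then have "{v. x v \<noteq> 0} \<in> K" using abstract_complex_face[OF assms(1,2)] assms(3) by simp
  then show ?thesis using s assms(4) by (simp add: topspace_realization)
qed

lemma continuous_map_realization:
  "continuous_map X (geometric_realization K) f \<longleftrightarrow>
     (\<forall>v. continuous_map X euclideanreal (\<lambda>x. f x v)) \<and>
     f ` topspace X \<subseteq> topspace (geometric_realization K)"
  unfolding topspace_realization geometric_realization_def continuous_map_in_subtopology
  by (simp add: continuous_map_componentwise_UNIV image_subset_iff Pi_iff)

lemma continuous_map_realization_coordinate:
  "continuous_map (geometric_realization K) euclideanreal (\<lambda>x. x v)"
  unfolding geometric_realization_def
  by (intro continuous_map_from_subtopology continuous_map_product_projection) auto

text \<open>The segment from \<open>x\<close> to \<open>f x\<close> stays in the realization because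
  \<open>carrier\<close> puts both of its ends into one closed simplex.\<close>

lemma straight_line_homotopy:
  assumes K: "abstract_complex K"
    and cont: "\<And>v. continuous_map (geometric_realization K) euclideanreal (\<lambda>x. f x v)"
    and carrier: "\<And>x. x \<in> topspace (geometric_realization K) \<Longrightarrow> 
          \<exists>\<rho>\<in>K. {v. x v \<noteq> 0} \<subseteq> \<rho> \<and> {v. f x v \<noteq> 0} \<subseteq> \<rho> \<and> sum (f x) \<rho> = 1"
    and pos: "\<And>x v. x \<in> topspace (geometric_realization K) \<Longrightarrow> 0 \<le> f x v"
  shows "homotopic_with (\<lambda>_. True) (geometric_realization K) (geometric_realization K) id f"
proof -
  let ?X = "geometric_realization K"
  let ?h = "\<lambda>(t::real, x) v. (1 - t) * x v + t * f x v"
  have mem: "?h (t,x) \<in> topspace ?X" if t: "t \<in> {0..1}" and x: "x \<in> topspace ?X" for t x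
  proof -
    obtain \<rho> where \<rho>: "\<rho> \<in> K" "{v. x v \<noteq> 0} \<subseteq> \<rho>" "{v. f x v \<noteq> 0} \<subseteq> \<rho>" "sum (f x) \<rho> = 1"
      using carrier[OF x] by blast
    have "sum x \<rho> = 1" using realization_sum[OF K x _ \<rho>(2)] abstract_complex_finite[OF K \<rho>(1)] by blast
    then have "sum (?h (t,x)) \<rho> = 1"
      using \<rho>(4) by (simp add: sum.distrib flip: sum_distrib_left)
    moreover have "0 \<le> ?h (t,x) v" for v
      using t x pos[OF x] by (auto simp: topspace_realization)
    moreover have "{v. ?h (t,x) v \<noteq> 0} \<subseteq> \<rho>"
    proof -
      have "?h (t,x) v = 0" if "v \<notin> \<rho>" for v
      proof -
        have "x v = 0" "f x v = 0" using that \<rho>(2,3) by auto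
        then show ?thesis by simp
      qed
      then show ?thesis by blast
    qed
    ultimately show ?thesis by (intro realization_memI[OF K \<rho>(1)])
  qed
  have c1: "continuous_map (prod_topology (top_of_set {0..1}) ?X) euclideanreal (\<lambda>p. fst p)"
    using continuous_map_fst continuous_map_into_fulltopology by blast
  have c2: "continuous_map (prod_topology (top_of_set {0..1::real}) ?X) euclideanreal (\<lambda>p. snd p v)" for v
    using continuous_map_compose[OF continuous_map_snd continuous_map_realization_coordinate]
    by (simp add: o_def)
  have c3: "continuous_map (prod_topology (top_of_set {0..1::real}) ?X) euclideanreal (\<lambda>p. f (snd p) v)" for v
    using continuous_map_compose[OF continuous_map_snd cont] by (simp add: o_def)
  have "continuous_map (prod_topology (top_of_set {0..1}) ?X) ?X ?h"
    unfolding continuous_map_realization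
  proof (intro conjI allI)
    fix v
    show "continuous_map (prod_topology (top_of_set {0..1}) ?X) euclideanreal (\<lambda>p. ?h p v)"
      unfolding case_prod_unfold
      by (intro continuous_map_add continuous_map_real_mult continuous_map_diff c1 c2 c3) simp_all
  next
    show "?h ` topspace (prod_topology (top_of_set {0..1}) ?X) \<subseteq> topspace ?X"
      using mem by auto
  qed
  then show ?thesis
    unfolding homotopic_with_def by (intro exI[of _ ?h]) auto
qed

lemma contractible_complex_cone:
  assumes K: "abstract_complex K" and q: "{q} \<in> K" and cone: "\<And>\<tau>. \<tau> \<in> K \<Longrightarrow> insert q \<tau> \<in> K"
  shows "contractible_complex K"
proof -
  let ?e = "\<lambda>v. if v = q then 1 else 0 :: real"
  have "?e \<in> topspace (geometric_realization K)"
    by (rule realization_memI[OF K q]) auto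
  moreover have "homotopic_with (\<lambda>_. True) (geometric_realization K) (geometric_realization K) id (\<lambda>x. ?e)"
  proof (rule straight_line_homotopy[OF K])
    fix x :: "'a \<Rightarrow> real" assume x: "x \<in> topspace (geometric_realization K)"
    let ?\<rho> = "insert q {v. x v \<noteq> 0}"
    have "?\<rho> \<in> K" using x cone by (auto simp: topspace_realization)
    then show "\<exists>\<rho>\<in>K. {v. x v \<noteq> 0} \<subseteq> \<rho> \<and> {v. ?e v \<noteq> 0} \<subseteq> \<rho> \<and> sum ?e \<rho> = 1"
      using abstract_complex_finite[OF K \<open>?\<rho> \<in> K\<close>] by (intro bexI[of _ ?\<rho>]) auto
  qed auto
  ultimately show ?thesis
    unfolding contractible_complex_def contractible_space_def by blast
qed

lemma continuous_map_Min:
  assumes "finite I" "I \<noteq> {}" "\<And>i. i \<in> I \<Longrightarrow> continuous_map X euclideanreal (f i)"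
  shows "continuous_map X euclideanreal (\<lambda>x. Min ((\<lambda>i. f i x) ` I))"
  using assms
proof (induction I rule: finite_ne_induct)
  case (insert i I)
  then show ?case by (simp add: continuous_map_real_min)
qed auto

text \<open>The deformation moves, at constant speed, the weight common to all vertices of \<open>\<sigma>\<close> to \<open>w\<close>.\<close>

lemma contractible_complex_collapse:
  assumes K: "abstract_complex K"
    and \<sigma>: "finite \<sigma>" "\<sigma> \<noteq> {}" "w \<notin> \<sigma>"
    and cone: "\<And>\<tau>. \<tau> \<in> K \<Longrightarrow> \<sigma> \<subseteq> \<tau> \<Longrightarrow> insert w \<tau> \<in> K"
    and L: "contractible_complex {\<tau>\<in>K. \<not> \<sigma> \<subseteq> \<tau>}"
  shows "contractible_complex K"
proof -
  let ?L = "{\<tau>\<in>K. \<not> \<sigma> \<subseteq> \<tau>}"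
  let ?X = "geometric_realization K" and ?Y = "geometric_realization ?L"
  have abL: "abstract_complex ?L"
    using K by (auto simp: abstract_complex_def)
  define \<mu> where "\<mu> x = Min ((\<lambda>v. x v) ` \<sigma>)" for x :: "'a \<Rightarrow> real"
  define r where "r x v = x v - (if v \<in> \<sigma> then \<mu> x else 0) + (if v = w then card \<sigma> * \<mu> x else 0)"
    for x v
  have \<mu>cont: "continuous_map ?X euclideanreal \<mu>"
    unfolding \<mu>_def using \<sigma> by (intro continuous_map_Min continuous_map_realization_coordinate) auto
  have rcont: "continuous_map ?X euclideanreal (\<lambda>x. r x v)" for v
    unfolding r_def 
    by (cases "v \<in> \<sigma>"; cases "v = w")
      (simp_all add: continuous_map_diff continuous_map_add continuous_map_real_mult \<mu>cont continuous_map_realization_coordinate)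
  have \<mu>le: "\<mu> x \<le> x v" if "v \<in> \<sigma>" for x v
    unfolding \<mu>_def using that \<sigma> by auto
  have \<mu>ex: "\<exists>v\<in>\<sigma>. \<mu> x = x v" for x
    proof -
    have "\<mu> x \<in> x ` \<sigma>" unfolding \<mu>_def using \<sigma> by (intro Min_in) auto
    then show ?thesis by auto
  qed
  have car: "\<exists>\<rho>\<in>K. {v. x v \<noteq> 0} \<subseteq> \<rho> \<and> {v. r x v \<noteq> 0} \<subseteq> \<rho> \<and> sum (r x) \<rho> = 1"
    and pos: "0 \<le> r x v" 
    and notin: "\<not> \<sigma> \<subseteq> {v. r x v \<noteq> 0}"
    if x: "x \<in> topspace ?X" for x v
  proof -
    have x0: "\<And>v. 0 \<le> x v" using x by (auto simp: topspace_realization)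
    have \<mu>0: "0 \<le> \<mu> x" using \<mu>ex[of x] x0 by auto
    show "0 \<le> r x v"
      unfolding r_def using x0[of v] \<mu>0 \<mu>le[of v x] by auto
    obtain u where u: "u \<in> \<sigma>" "\<mu> x = x u" using \<mu>ex by blast
    \<comment> \<open>A vertex of \<sigma> attaining the minimum loses its whole weight, so the
      support of \<open>r x\<close> no longer contains \<sigma>.\<close>
    then have "r x u = 0" using \<sigma> by (auto simp: r_def)
    then show "\<not> \<sigma> \<subseteq> {v. r x v \<noteq> 0}" using u by auto
    have sx: "{v. x v \<noteq> 0} \<in> K" using x by (auto simp: topspace_realization)
    show "\<exists>\<rho>\<in>K. {v. x v \<noteq> 0} \<subseteq> \<rho> \<and> {v. r x v \<noteq> 0} \<subseteq> \<rho> \<and> sum (r x) \<rho> = 1"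
    proof (cases "\<mu> x = 0")
      case True
      then have "r x = x" by (auto simp: r_def)
      then show ?thesis using sx x by (intro bexI[OF _ sx]) (auto simp: topspace_realization)
    next
      case False
      \<comment> \<open>A positive minimum puts \<sigma> into the support of \<open>x\<close>; the
        cone hypothesis then gives a simplex that also contains \<open>w\<close>.\<close>
      then have sub: "\<sigma> \<subseteq> {v. x v \<noteq> 0}" using \<mu>le[of _ x] \<mu>0 by force
      let ?\<rho> = "insert w {v. x v \<noteq> 0}"
      have \<rho>: "?\<rho> \<in> K" using cone[OF sx sub] .
      have fin: "finite ?\<rho>" using abstract_complex_finite[OF K \<rho>] .
      have "sum (r x) ?\<rho> = sum x ?\<rho> - (\<Sum>v\<in>?\<rho>. if v \<in> \<sigma> then \<mu> x else 0)
            + (\<Sum>v\<in>?\<rho>. if v = w then card \<sigma> * \<mu> x else 0)"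
        unfolding r_def by (simp only: sum.distrib sum_subtractf)
      also have "(\<Sum>v\<in>?\<rho>. if v \<in> \<sigma> then \<mu> x else 0) = card \<sigma> * \<mu> x"
      proof -
        have "?\<rho> \<inter> \<sigma> = \<sigma>" using sub by auto
        then show ?thesis using fin by (simp only: sum.inter_restrict[symmetric]) simp
      qed
      also have "(\<Sum>v\<in>?\<rho>. if v = w then card \<sigma> * \<mu> x else 0) = card \<sigma> * \<mu> x"
        using fin by (subst sum.delta) auto
      also have "sum x ?\<rho> = 1" using realization_sum[OF K x fin] by auto
      finally have "sum (r x) ?\<rho> = 1" by simp
      moreover have "{v. r x v \<noteq> 0} \<subseteq> ?\<rho>" using sub by (auto simp: r_def)
      ultimately show ?thesis using \<rho> by blast
    qed
  qed
  have hom: "homotopic_with (\<lambda>_. True) ?X ?X id r"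
    by (rule straight_line_homotopy[OF K rcont car pos])
  have "r ` topspace ?X \<subseteq> topspace ?X"
    using homotopic_with_imp_continuous_maps[OF hom]
    by (auto simp: continuous_map_def)
  then have "r ` topspace ?X \<subseteq> topspace ?Y"
    using notin by (auto simp: topspace_realization)
  then have rY: "continuous_map ?X ?Y r"
    using rcont unfolding continuous_map_realization by auto
  have i: "continuous_map ?Y ?X id"
    unfolding continuous_map_realization
    by (auto simp: continuous_map_realization_coordinate topspace_realization)
  have ne: "topspace ?X \<noteq> {}"
    using L continuous_map_image_subset_topspace[OF i] unfolding contractible_complex_def by auto
  \<comment> \<open>The map \<open>r\<close> is homotopic to the identity and factors through the
    contractible realization of \<open>?L\<close>, hence it is null-homotopic.\<close>
  obtain a where a: "homotopic_with (\<lambda>_. True) ?X ?X r (\<lambda>x. a)"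
    using nullhomotopic_through_contractible_space[OF rY i] L
    unfolding contractible_complex_def by (auto simp: o_def)
  then have "homotopic_with (\<lambda>_. True) ?X ?X id (\<lambda>x. a)"
    using hom homotopic_with_trans by blast
  then show ?thesis
    using ne unfolding contractible_complex_def contractible_space_def by blast
qed

text \<open>The index \<open>i\<close> collapses the open star of \<open>\<sigma> i\<close>, whose link is then a cone with apex \<open>w i\<close>;
  indices are processed by increasing \<open>\<mu>\<close>.\<close>

lemma contractible_complex_collapses:
  fixes \<mu> :: "'i \<Rightarrow> nat"
  assumes K: "abstract_complex K" and "finite I"
    and \<sigma>: "\<And>i. i \<in> I \<Longrightarrow> finite (\<sigma> i) \<and> \<sigma> i \<noteq> {} \<and> w i \<notin> \<sigma> i"
    and cone: "\<And>i \<tau>. i \<in> I \<Longrightarrow> \<tau> \<in> K \<Longrightarrow> \<sigma> i \<subseteq> \<tau> \<Longrightarrow> 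
                 (\<And>j. j \<in> I \<Longrightarrow> \<mu> j < \<mu> i \<Longrightarrow> \<not> \<sigma> j \<subseteq> \<tau>) \<Longrightarrow> insert (w i) \<tau> \<in> K"
    and pres: "\<And>i j \<tau>. i \<in> I \<Longrightarrow> j \<in> I \<Longrightarrow> \<tau> \<in> K \<Longrightarrow> \<sigma> i \<subseteq> \<tau> \<Longrightarrow> \<sigma> j \<subseteq> insert (w i) \<tau> \<Longrightarrow> \<sigma> j \<subseteq> \<tau>"
    and L: "contractible_complex {\<tau>\<in>K. \<forall>i\<in>I. \<not> \<sigma> i \<subseteq> \<tau>}"
  shows "contractible_complex K"
  using assms(2-)
proof (induction "card I" arbitrary: I)
  case 0
  have "I = {}" using "0.hyps" "0.prems"(1) by simp
  then show ?case using "0.prems"(5) by simp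
next
  case (Suc c)
  have "I \<noteq> {}" using Suc.hyps(2) by auto
  \<comment> \<open>The induction splits off the index that is collapsed last: the others reduce
    \<open>K\<close> to \<open>?K\<close>, and \<open>\<sigma> i\<close> is then collapsed inside
    \<open>?K\<close>.\<close>
  then have "Max (\<mu> ` I) \<in> \<mu> ` I" using Suc.prems(1) by (intro Max_in) auto
  then obtain i where i: "i \<in> I" "\<mu> i = Max (\<mu> ` I)" by auto
  have i: "i \<in> I" "\<And>j. j \<in> I \<Longrightarrow> \<mu> j \<le> \<mu> i"
    using i Suc.prems(1) by auto
  let ?J = "I - {i}"
  show ?case
  proof (rule Suc.hyps(1)[of ?J])
    show "c = card ?J" using Suc.hyps(2) i Suc.prems(1) by simp
    show "insert (w j) \<tau> \<in> K" if "j \<in> ?J" "\<tau> \<in> K" "\<sigma> j \<subseteq> \<tau>" 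
      "\<And>l. l \<in> ?J \<Longrightarrow> \<mu> l < \<mu> j \<Longrightarrow> \<not> \<sigma> l \<subseteq> \<tau>" for j \<tau>
    proof (rule Suc.prems(3))
      fix l assume "l \<in> I" "\<mu> l < \<mu> j"
      moreover have "l \<noteq> i" using i(2)[of j] \<open>\<mu> l < \<mu> j\<close> that(1) by auto
      ultimately show "\<not> \<sigma> l \<subseteq> \<tau>" using that(4) by blast
    qed (use that in auto)
    let ?K = "{\<tau>\<in>K. \<forall>i\<in>?J. \<not> \<sigma> i \<subseteq> \<tau>}"
    have "abstract_complex ?K"
      using K unfolding abstract_complex_def by blast
    moreover have "insert (w i) \<tau> \<in> ?K" if "\<tau> \<in> ?K" "\<sigma> i \<subseteq> \<tau>" for \<tau>
    proof -
      \<comment> \<open>Every index with smaller \<open>\<mu>\<close> belongs to \<open>?J\<close>,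
        so its open star is already absent from \<open>?K\<close>.\<close>
      have "insert (w i) \<tau> \<in> K"
        using that by (intro Suc.prems(3)[OF i(1)]) (auto simp: nat_less_le)
      then show ?thesis
        using that Suc.prems(4)[OF i(1)] by blast
    qed
    moreover have "{\<tau> \<in> ?K. \<not> \<sigma> i \<subseteq> \<tau>} = {\<tau>\<in>K. \<forall>i\<in>I. \<not> \<sigma> i \<subseteq> \<tau>}"
      using i(1) by blast
    ultimately show "contractible_complex ?K"
      using contractible_complex_collapse[of ?K "\<sigma> i" "w i"] Suc.prems(2)[OF i(1)] Suc.prems(5)
      by simp
    show "finite ?J" using Suc.prems(1) by simp
    show "finite (\<sigma> j) \<and> \<sigma> j \<noteq> {} \<and> w j \<notin> \<sigma> j" if "j \<in> ?J" for j
      using Suc.prems(2) that by blast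
    show "\<sigma> l \<subseteq> \<tau>" if "j \<in> ?J" "l \<in> ?J" "\<tau> \<in> K" "\<sigma> j \<subseteq> \<tau>" "\<sigma> l \<subseteq> insert (w j) \<tau>" for j l \<tau>
      using Suc.prems(4)[of j l \<tau>] that by blast
  qed
qed

section \<open>Order complexes of finite posets and contraction by meets\<close>

lemma abstract_complex_order_complex: "abstract_complex (order_complex V le)"
  unfolding abstract_complex_def order_complex_def by (auto intro: finite_subset)

locale finite_poset =
  fixes V :: "'v set" and le :: "'v \<Rightarrow> 'v \<Rightarrow> bool"
  assumes finite_carrier: "finite V"
    and refl: "x \<in> V \<Longrightarrow> le x x"
    and antisym: "x \<in> V \<Longrightarrow> y \<in> V \<Longrightarrow> le x y \<Longrightarrow> le y x \<Longrightarrow> x = y"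
    and trans: "x \<in> V \<Longrightarrow> y \<in> V \<Longrightarrow> z \<in> V \<Longrightarrow> le x y \<Longrightarrow> le y z \<Longrightarrow> le x z"
begin

lemma subposet: "W \<subseteq> V \<Longrightarrow> finite_poset W le"
  using finite_carrier refl antisym trans
  by unfold_locales (blast intro: finite_subset)+

text \<open>Here \<open>f y\<close> is the meet of \<open>y\<close> and \<open>q\<close> inside
  \<open>U\<close>. Collapsing the stars of \<open>insert y \<rho>\<close>, smaller \<open>y\<close>
  first, leaves only simplices in which everything from \<open>U\<close> lying over \<rho> is below
  \<open>q\<close>. The empty \<rho> treats the whole poset, a singleton \<rho> the part above one
  element.\<close>

lemma collapse_to_meet_closed:
  assumes \<rho>: "finite \<rho>" "\<rho> \<subseteq> V"
    and U: "U = {y\<in>V. \<forall>x\<in>\<rho>. le x y \<and> x \<noteq> y}" and q: "q \<in> U"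
    and meet: "\<And>y. y \<in> U \<Longrightarrow> f y \<in> U \<and> le (f y) y \<and> le (f y) q"
              "\<And>y z. y \<in> U \<Longrightarrow> z \<in> U \<Longrightarrow> le z y \<Longrightarrow> le z q \<Longrightarrow> le z (f y)"
    and L: "contractible_complex {\<tau>\<in>order_complex V le. \<forall>y\<in>U. \<not> le y q \<longrightarrow> \<not> insert y \<rho> \<subseteq> \<tau>}"
  shows "contractible_complex (order_complex V le)"
proof -
  define bad where "bad = {y\<in>U. \<not> le y q}"
  define \<mu> where "\<mu> y = card {z\<in>V. le z y}" for y
  have UV: "U \<subseteq> V" and badU: "bad \<subseteq> U" by (auto simp: U bad_def)
  show ?thesis
  proof (rule contractible_complex_collapses[where I=bad and \<sigma>="\<lambda>y. insert y \<rho>" and w=f and \<mu>=\<mu>])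
    show "abstract_complex (order_complex V le)" by (rule abstract_complex_order_complex)
    show "finite bad" using finite_subset[OF subset_trans[OF badU UV] finite_carrier] .
    show "finite (insert y \<rho>) \<and> insert y \<rho> \<noteq> {} \<and> f y \<notin> insert y \<rho>" if "y \<in> bad" for y
      using meet(1)[of y] that \<rho> by (auto simp: bad_def U)
    show "insert z \<rho> \<subseteq> \<tau>" if "y \<in> bad" "z \<in> bad" "insert z \<rho> \<subseteq> insert (f y) \<tau>" for y z \<tau>
      using meet(1)[of y] that by (auto simp: bad_def U)
    show "contractible_complex {\<tau> \<in> order_complex V le. \<forall>i\<in>bad. \<not> insert i \<rho> \<subseteq> \<tau>}"
    proof -
      have "{\<tau> \<in> order_complex V le. \<forall>i\<in>bad. \<not> insert i \<rho> \<subseteq> \<tau>} =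
        {\<tau>\<in>order_complex V le. \<forall>y\<in>U. \<not> le y q \<longrightarrow> \<not> insert y \<rho> \<subseteq> \<tau>}"
        unfolding bad_def by blast
      then show ?thesis using L by simp
    qed
    fix y \<tau>
    assume y: "y \<in> bad" and \<tau>: "\<tau> \<in> order_complex V le" "insert y \<rho> \<subseteq> \<tau>"
      and least: "\<And>z. z \<in> bad \<Longrightarrow> \<mu> z < \<mu> y \<Longrightarrow> \<not> insert z \<rho> \<subseteq> \<tau>"
    have yU: "y \<in> U" and yV: "y \<in> V" using y badU UV by auto
    note fy = meet(1)[OF yU]
    have fV: "f y \<in> V" using fy UV by auto
    have \<tau>V: "\<tau> \<subseteq> V" and ch: "\<And>a b. a \<in> \<tau> \<Longrightarrow> b \<in> \<tau> \<Longrightarrow> le a b \<or> le b a"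
      using \<tau>(1) by (auto simp: order_complex_def)
    \<comment> \<open>This makes \<open>f y\<close> a cone apex. What is above \<open>y\<close> is
      above \<open>f y\<close>. What is strictly below \<open>y\<close> and in \<open>U\<close> was
      not collapsed earlier, so it is below \<open>q\<close> and hence below the meet. What is
      outside \<open>U\<close> is below some element of \<rho>.\<close>
    have "le (f y) z \<or> le z (f y)" if z: "z \<in> \<tau>" for z
    proof (cases "le y z")
      case True
      then show ?thesis using trans fy yV fV z \<tau>V by blast
    next
      case False
      have zV: "z \<in> V" using z \<tau>V by auto
      have zy: "le z y" using False ch[of y z] \<tau>(2) z by auto
      show ?thesis
      proof (cases "z \<in> U")
        case True
        have "{v\<in>V. le v z} \<subset> {v\<in>V. le v y}"
          using False zy zV yV trans refl by blast
        then have "\<mu> z < \<mu> y" unfolding \<mu>_def 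
          using finite_carrier by (intro psubset_card_mono) auto
        then have "z \<notin> bad" using least z \<tau>(2) by blast
        then show ?thesis using True meet(2)[OF yU True zy] by (auto simp: bad_def)
      next
        case False
        then obtain x where x: "x \<in> \<rho>" "\<not> (le x z \<and> x \<noteq> z)" using zV by (auto simp: U)
        then have "le z x" using ch[of x z] z \<tau>(2) refl zV by auto
        moreover have "le x (f y)" using x fy by (auto simp: U)
        ultimately show ?thesis using trans[of z x "f y"] x \<rho> zV fV by blast
      qed
    qed
    then show "insert (f y) \<tau> \<in> order_complex V le"
      using \<tau>(1) fV refl[OF fV] by (auto simp: order_complex_def)
  qed
qed

text \<open>After the collapses all remaining vertices are below \<open>q\<close>, so
  \<open>q\<close> is a cone apex.\<close>

lemma contractible_if_meets:
  assumes q: "q \<in> V"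
    and meet: "\<And>y. y \<in> V \<Longrightarrow> f y \<in> V \<and> le (f y) y \<and> le (f y) q"
              "\<And>y z. y \<in> V \<Longrightarrow> z \<in> V \<Longrightarrow> le z y \<Longrightarrow> le z q \<Longrightarrow> le z (f y)"
  shows "contractible_complex (order_complex V le)"
proof (rule collapse_to_meet_closed[where \<rho>="{}" and U=V and f=f and q=q])
  let ?L = "{\<tau>\<in>order_complex V le. \<forall>y\<in>V. \<not> le y q \<longrightarrow> \<not> insert y {} \<subseteq> \<tau>}"
  show "contractible_complex ?L"
  proof (rule contractible_complex_cone)
    show "abstract_complex ?L"
      using abstract_complex_order_complex[of V le] unfolding abstract_complex_def by blast
    show "{q} \<in> ?L" using q refl by (auto simp: order_complex_def)
    show "insert q \<tau> \<in> ?L" if "\<tau> \<in> ?L" for \<tau>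
      using that q refl by (auto simp: order_complex_def subset_eq)
  qed
qed (use assms in auto)

text \<open>After the collapses, whatever shares a simplex with \<open>x\<close> is either above
  \<open>x\<close> and below \<open>q\<close>, or below \<open>x\<close> and hence below
  \<open>q\<close>. So the link of \<open>x\<close> is a cone with apex \<open>q\<close>, and
  \<open>x\<close> can be deleted.\<close>

lemma contractible_if_upper_meets:
  assumes x: "x \<in> V" and U: "U = {y\<in>V. le x y \<and> x \<noteq> y}" and q: "q \<in> U"
    and meet: "\<And>y. y \<in> U \<Longrightarrow> f y \<in> U \<and> le (f y) y \<and> le (f y) q"
              "\<And>y z. y \<in> U \<Longrightarrow> z \<in> U \<Longrightarrow> le z y \<Longrightarrow> le z q \<Longrightarrow> le z (f y)"
    and del: "contractible_complex (order_complex (V - {x}) le)"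
  shows "contractible_complex (order_complex V le)"
proof (rule collapse_to_meet_closed[where \<rho>="{x}" and U=U and f=f and q=q])
  let ?L = "{\<tau>\<in>order_complex V le. \<forall>y\<in>U. \<not> le y q \<longrightarrow> \<not> {y,x} \<subseteq> \<tau>}"
  show "contractible_complex ?L"
  proof (rule contractible_complex_collapse[where \<sigma>="{x}" and w=q])
    show "abstract_complex ?L"
      using abstract_complex_order_complex[of V le] unfolding abstract_complex_def by blast
    show "q \<notin> {x}" using q U by auto
    show "insert q \<tau> \<in> ?L" if \<tau>: "\<tau> \<in> ?L" "{x} \<subseteq> \<tau>" for \<tau>
    proof -
      have "le q z \<or> le z q" if z: "z \<in> \<tau>" for z
      proof (cases "z \<in> U")
        case True
        then show ?thesis using \<tau> z by auto
      next
        case False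
        then have "le z x" using \<tau> z refl by (auto simp: order_complex_def U)
        then show ?thesis using trans[of z x q] q x z \<tau> by (auto simp: U order_complex_def)
      qed
      then show ?thesis using \<tau> q refl by (auto simp: order_complex_def U)
    qed
    have "{\<tau> \<in> ?L. \<not> {x} \<subseteq> \<tau>} = order_complex (V - {x}) le"
      by (auto simp: order_complex_def)
    then show "contractible_complex {\<tau> \<in> ?L. \<not> {x} \<subseteq> \<tau>}" using del by simp
  qed auto
qed (use assms in auto)

end

text \<open>Deleting a maximal element \<open>x\<close> of \<open>X\<close> first means that
  everything strictly above \<open>x\<close> lies in \<open>W\<close>, where the meets with
  \<open>q x\<close> are available. The induction then continues with the rest of
  \<open>X\<close>.\<close>

lemma contractible_if_removable:
  assumes "finite_poset (W \<union> X) le" and "W \<inter> X = {}"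
    and "\<And>x. x \<in> X \<Longrightarrow> q x \<in> W \<and> le x (q x)"
    and "\<And>x y. x \<in> X \<Longrightarrow> y \<in> W \<Longrightarrow> le x y \<Longrightarrow>
           f x y \<in> W \<and> le x (f x y) \<and> le (f x y) y \<and> le (f x y) (q x)"
    and "\<And>x y z. x \<in> X \<Longrightarrow> y \<in> W \<Longrightarrow> z \<in> W \<Longrightarrow> le x y \<Longrightarrow> le x z \<Longrightarrow>
           le z y \<Longrightarrow> le z (q x) \<Longrightarrow> le z (f x y)"
    and "contractible_complex (order_complex W le)"
  shows "contractible_complex (order_complex (W \<union> X) le)"
  using assms
proof (induction "card X" arbitrary: X)
  case 0
  have "finite (W \<union> X)" using "0.prems"(1) by (rule finite_poset.finite_carrier)
  then have "X = {}" using "0.hyps" by simp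
  then show ?case using "0.prems"(6) by simp
next
  case (Suc c)
  interpret finite_poset "W \<union> X" le by (rule Suc.prems(1))
  have fin: "finite X" using finite_carrier by auto
  \<comment> \<open>An element with the most elements of \<open>X\<close> below it is maximal in
    \<open>X\<close>.\<close>
  define \<mu> where "\<mu> x = card {z\<in>X. le z x}" for x
  have "Max (\<mu> ` X) \<in> \<mu> ` X" using Suc.hyps(2) fin by (intro Max_in) auto
  then obtain x where x: "x \<in> X" "\<mu> x = Max (\<mu> ` X)" by auto
  have top: "y = x" if "y \<in> X" "le x y" for y
  proof (rule ccontr)
    assume "y \<noteq> x"
    then have "y \<notin> {z\<in>X. le z x}" using that x(1) antisym by blast
    moreover have "{z\<in>X. le z x} \<subseteq> {z\<in>X. le z y}" using that x(1) trans by blast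
    moreover have "y \<in> {z\<in>X. le z y}" using that refl by auto
    ultimately have "{z\<in>X. le z x} \<subset> {z\<in>X. le z y}" by blast
    then have "\<mu> x < \<mu> y" unfolding \<mu>_def using fin by (intro psubset_card_mono) auto
    moreover have "\<mu> y \<le> \<mu> x" using x(2) fin that(1) by simp
    ultimately show False by simp
  qed
  let ?U = "{y \<in> W \<union> X. le x y \<and> x \<noteq> y}"
  have U: "y \<in> ?U \<longleftrightarrow> y \<in> W \<and> le x y" for y
    using top x(1) Suc.prems(2) by blast
  show ?case
  proof (rule contractible_if_upper_meets[where x=x and U="?U" and q="q x" and f="f x"])
    show "q x \<in> ?U" unfolding U using Suc.prems(3) x by blast
    show "f x y \<in> ?U \<and> le (f x y) y \<and> le (f x y) (q x)" if "y \<in> ?U" for y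
      using that unfolding U using Suc.prems(4) x by blast
    show "le z (f x y)" if "y \<in> ?U" "z \<in> ?U" "le z y" "le z (q x)" for y z
      using that unfolding U using Suc.prems(5) x by blast
    have eq: "W \<union> X - {x} = W \<union> (X - {x})" using x(1) Suc.prems(2) by blast
    show "contractible_complex (order_complex (W \<union> X - {x}) le)"
      unfolding eq
    proof (rule Suc.hyps(1))
      show "c = card (X - {x})" using Suc.hyps(2) x fin by simp
      show "finite_poset (W \<union> (X - {x})) le" by (rule subposet) auto
    qed (use Suc.prems in auto)
  qed (use x in auto)
qed

section \<open>Noncrossing partitions of a convex polygon\<close>

text \<open>The four-point pattern starts in \<open>A\<close>; the one starting in \<open>B\<close>
  is \<open>crossing B A\<close>. Since \<open>noncrossing\<close> runs over ordered pairs, it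
  excludes both.\<close>

definition crossing :: "nat set \<Rightarrow> nat set \<Rightarrow> bool" where
  "crossing A B \<longleftrightarrow> (\<exists>a\<in>A. \<exists>b\<in>B. \<exists>c\<in>A. \<exists>d\<in>B. a < b \<and> b < c \<and> c < d)"

lemma crossingI: "a \<in> A \<Longrightarrow> b \<in> B \<Longrightarrow> c \<in> A \<Longrightarrow> d \<in> B \<Longrightarrow> a < b \<Longrightarrow> b < c \<Longrightarrow> c < d \<Longrightarrow> crossing A B"
  by (auto simp: crossing_def)

definition noncrossing :: "nat set set \<Rightarrow> bool" where
  "noncrossing \<pi> \<longleftrightarrow> (\<forall>A\<in>\<pi>. \<forall>B\<in>\<pi>. A \<noteq> B \<longrightarrow> \<not> crossing A B)"

text \<open>Twice the signed area of the triangle. As a function of \<open>c\<close> it is affine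
  and vanishes on the line through \<open>a\<close> and \<open>b\<close>, so its sign tells the two
  sides of that line apart.\<close>

definition orient :: "real^2 \<Rightarrow> real^2 \<Rightarrow> real^2 \<Rightarrow> real" where
  "orient a b c = (b - a) $ 1 * (c - a) $ 2 - (b - a) $ 2 * (c - a) $ 1"

lemma clockwise_iff_orient: "clockwise a b c \<longleftrightarrow> orient a b c < 0"
  by (simp add: clockwise_def orient_def)

lemma orient_rotate: "orient b c a = orient a b c"
  by (simp add: orient_def algebra_simps)

lemma orient_swap: "orient a c b = - orient a b c"
  by (simp add: orient_def algebra_simps)

lemma orient_degenerate: "orient a a c = 0" "orient a c a = 0" "orient c a a = 0"
  by (simp_all add: orient_def algebra_simps)

lemma orient_affine:
  assumes "u + v = 1"
  shows "orient a b (u *\<^sub>R x + v *\<^sub>R y) = u * orient a b x + v * orient a b y"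
proof -
  have v: "v = 1 - u" using assms by simp
  show ?thesis by (simp add: orient_def v algebra_simps)
qed

lemma convex_orient_pos: "convex {x. 0 < orient a b x}"
  unfolding convex_def
proof (clarsimp simp: orient_affine)
  fix x y and u v :: real
  assume *: "0 < orient a b x" "0 < orient a b y" "0 \<le> u" "0 \<le> v" "u + v = 1"
  then have "u > 0 \<or> v > 0" by auto
  then show "0 < u * orient a b x + v * orient a b y"
    using * by (auto intro: add_pos_nonneg add_nonneg_pos)
qed

lemma convex_orient_nonneg: "convex {x. 0 \<le> orient a b x}"
  unfolding convex_def by (clarsimp simp: orient_affine)

lemma hulls_disjoint_if_orient:
  assumes "\<And>x. x \<in> S \<Longrightarrow> orient a b x \<le> 0" "\<And>x. x \<in> T \<Longrightarrow> 0 < orient a b x"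
  shows "convex hull S \<inter> convex hull T = {}"
proof -
  have *: "orient b a x = - orient a b x" for x by (simp add: orient_def algebra_simps)
  have "convex hull S \<subseteq> {x. 0 \<le> orient b a x}"
    using assms(1) by (intro hull_minimal convex_orient_nonneg) (auto simp: *)
  moreover have "convex hull T \<subseteq> {x. 0 < orient a b x}"
    using assms(2) by (intro hull_minimal convex_orient_pos) auto
  ultimately show ?thesis by (fastforce simp: *)
qed

text \<open>Up to a common factor both sides are the intersection point of the lines
  \<open>a c\<close> and \<open>b d\<close>: each endpoint is weighted by the distance of the
  opposite endpoint from the other line. The next lemma says that the total weights agree, so
  normalizing yields the same point.\<close>

lemma orient_segments_intersect:
  "orient a c b *\<^sub>R d - orient a c d *\<^sub>R b = orient b d c *\<^sub>R a - orient b d a *\<^sub>R c"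
  by (simp add: vec_eq_iff forall_2 orient_def algebra_simps)

lemma orient_segments_denominator:
  "orient a c b - orient a c d = orient b d c - orient b d a"
  by (simp add: orient_def algebra_simps)

lemma convex_hull_combination:
  assumes "x \<in> S" "y \<in> S" "(0::real) < s" "0 < t"
  shows "(1 / (s + t)) *\<^sub>R (s *\<^sub>R x + t *\<^sub>R y) \<in> convex hull S"
proof -
  have "(s / (s + t)) *\<^sub>R x + (t / (s + t)) *\<^sub>R y \<in> convex hull S"
    using assms by (intro convexD[OF convex_convex_hull] hull_inc) (auto simp flip: add_divide_distrib)
  then show ?thesis by (simp add: scaleR_add_right)
qed

context
  fixes m :: nat and P :: "nat \<Rightarrow> real^2"
  assumes P: "convex_polygon m P"
begin

lemma polygon_orient: "1 \<le> i \<Longrightarrow> i < j \<Longrightarrow> j < l \<Longrightarrow> l \<le> m \<Longrightarrow> orient (P i) (P j) (P l) < 0"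
  using P by (simp add: convex_polygon_def clockwise_iff_orient)

lemma polygon_orient_inside:
  "a \<in> {1..m} \<Longrightarrow> b \<in> {1..m} \<Longrightarrow> a < x \<Longrightarrow> x < b \<Longrightarrow> orient (P a) (P b) (P x) > 0"
  using polygon_orient[of a x b] orient_swap[of "P a" "P b" "P x"] by simp

lemma polygon_orient_outside:
  "a \<in> {1..m} \<Longrightarrow> b \<in> {1..m} \<Longrightarrow> a < b \<Longrightarrow> x \<in> {1..m} \<Longrightarrow> x < a \<or> b < x \<Longrightarrow> orient (P a) (P b) (P x) < 0"
  using polygon_orient[of x a b] polygon_orient[of a b x] orient_rotate[of "P a" "P b" "P x"] by auto

text \<open>The chords \<open>a c\<close> and \<open>b d\<close> meet: each has the endpoints of the
  other strictly on different sides, which makes all four weights positive.\<close>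

lemma hulls_intersect_if_crossing:
  assumes "A \<subseteq> {1..m}" "B \<subseteq> {1..m}" "crossing A B"
  shows "convex hull (P ` A) \<inter> convex hull (P ` B) \<noteq> {}"
proof -
  obtain a b c d where abcd: "a \<in> A" "b \<in> B" "c \<in> A" "d \<in> B" "a < b" "b < c" "c < d"
    using assms(3) by (auto simp: crossing_def)
  then have m: "a \<in> {1..m}" "b \<in> {1..m}" "c \<in> {1..m}" "d \<in> {1..m}" using assms by auto
  let ?b = "orient (P a) (P c) (P b)" and ?d = "- orient (P a) (P c) (P d)"
  let ?c = "orient (P b) (P d) (P c)" and ?a = "- orient (P b) (P d) (P a)"
  have pos: "0 < ?b" "0 < ?d" "0 < ?c" "0 < ?a"
    using polygon_orient_inside polygon_orient_outside m abcd by auto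
  have "(1 / (?b + ?d)) *\<^sub>R (?b *\<^sub>R P d + ?d *\<^sub>R P b) \<in> convex hull (P ` B)"
    using abcd pos by (intro convex_hull_combination) auto
  moreover have "(1 / (?c + ?a)) *\<^sub>R (?c *\<^sub>R P a + ?a *\<^sub>R P c) \<in> convex hull (P ` A)"
    using abcd pos by (intro convex_hull_combination) auto
  moreover have "?b + ?d = ?c + ?a" using orient_segments_denominator[of "P a" "P c" "P b" "P d"] by simp
  moreover have "?b *\<^sub>R P d + ?d *\<^sub>R P b = ?c *\<^sub>R P a + ?a *\<^sub>R P c"
    using orient_segments_intersect[of "P a" "P c" "P b" "P d"] by simp
  ultimately show ?thesis by auto
qed

text \<open>A chord of \<open>A\<close> spans a separating line. If no vertex of \<open>B\<close>
  lies between the extreme vertices of \<open>A\<close>, the chord joining these works. Otherwise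
  \<open>B\<close> lies inside a single gap between consecutive vertices of \<open>A\<close>, and
  the chord closing this gap works.\<close>

lemma hulls_disjoint_if_noncrossing_aux:
  assumes A: "A \<subseteq> {1..m}" and B: "B \<subseteq> {1..m}" and "A \<inter> B = {}" and "s \<in> A" "t \<in> A" "s < t"
    and nc: "\<not> crossing A B" "\<not> crossing B A"
  shows "convex hull (P ` A) \<inter> convex hull (P ` B) = {}"
proof -
  have fin: "finite A" using A finite_subset by blast
  have ne: "A \<noteq> {}" using assms by auto
  let ?s = "Min A" and ?t = "Max A"
  have st: "?s \<in> A" "?t \<in> A" "\<And>x. x \<in> A \<Longrightarrow> ?s \<le> x \<and> x \<le> ?t" using fin ne by auto
  have stm: "?s \<in> {1..m}" "?t \<in> {1..m}" using st A by blast+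
  have "?s < ?t" using st(3)[of s] st(3)[of t] \<open>s < t\<close> assms(4,5) by linarith
  show ?thesis
  proof (cases "\<exists>b\<in>B. ?s < b \<and> b < ?t")
    case False
    have out: "b < ?s \<or> ?t < b" if "b \<in> B" for b
      using False that st \<open>A \<inter> B = {}\<close> by (metis disjoint_iff linorder_neqE_nat)
    have neg: "orient (P ?t) (P ?s) x = - orient (P ?s) (P ?t) x" for x
      by (simp add: orient_def algebra_simps)
    show "convex hull (P ` A) \<inter> convex hull (P ` B) = {}"
    proof (rule hulls_disjoint_if_orient[of _ "P ?t" "P ?s"])
      fix x assume "x \<in> P ` A"
      then obtain a where a: "x = P a" "a \<in> A" by auto
      then consider "a = ?s" | "a = ?t" | "?s < a \<and> a < ?t" using st(3)[of a] by linarith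
      then show "orient (P ?t) (P ?s) x \<le> 0"
        using polygon_orient_inside[OF stm, of a] a by cases (auto simp: neg orient_degenerate)
    next
      fix x assume "x \<in> P ` B"
      then obtain b where b: "x = P b" "b \<in> B" by auto
      then show "orient (P ?t) (P ?s) x > 0"
        using polygon_orient_outside[OF stm \<open>?s < ?t\<close>, of b] out[of b] B by (auto simp: neg)
    qed
  next
    case True
    then obtain b where b: "b \<in> B" "?s < b" "b < ?t" by blast
    \<comment> \<open>The two neighbours of \<open>b\<close> in \<open>A\<close>; a vertex of
      \<open>B\<close> beyond either of them would form a crossing with \<open>b\<close>.\<close>
    let ?u = "Max {x\<in>A. x < b}" and ?v = "Min {x\<in>A. b < x}"
    have "?u \<in> {x\<in>A. x < b}" using fin b st by (intro Max_in) auto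
    then have u: "?u \<in> A" "?u < b" by auto
    have "?v \<in> {x\<in>A. b < x}" using fin b st by (intro Min_in) auto
    then have v: "?v \<in> A" "b < ?v" by auto
    have gap: "x \<le> ?u \<or> ?v \<le> x" if xA: "x \<in> A" for x
    proof -
      have "x \<noteq> b" using that b \<open>A \<inter> B = {}\<close> by auto
      then consider "x \<in> {x\<in>A. x < b}" | "x \<in> {x\<in>A. b < x}" using xA by fastforce
      then show ?thesis by cases (use fin in \<open>simp_all\<close>)
    qed
    have uvm: "?u \<in> {1..m}" "?v \<in> {1..m}" using u v A by blast+
    show ?thesis
    proof (rule hulls_disjoint_if_orient[of _ "P ?u" "P ?v"])
      fix x assume "x \<in> P ` A"
      then obtain a where a: "x = P a" "a \<in> A" by auto
      then consider "a = ?u" | "a = ?v" | "a < ?u \<or> ?v < a" using gap[of a] by linarith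
      then show "orient (P ?u) (P ?v) x \<le> 0"
      proof cases
        case 3
        have "?u < ?v" using u v by linarith
        then show ?thesis using polygon_orient_outside[OF uvm, of a] 3 a A by auto
      qed (auto simp: a orient_degenerate)
    next
      fix x assume "x \<in> P ` B"
      then obtain c where c: "x = P c" "c \<in> B" by auto
      have ne: "c \<noteq> ?u" "c \<noteq> ?v" using c u v \<open>A \<inter> B = {}\<close> by auto
      have "\<not> c < ?u" using nc(2) c u v b by (meson crossingI)
      moreover have "\<not> ?v < c" using nc(1) c u v b by (meson crossingI)
      ultimately show "0 < orient (P ?u) (P ?v) x"
        using polygon_orient_inside[OF uvm, of c] c ne by auto
    qed
  qed
qed

text \<open>As \<open>m\<close> is at least 3, there is a third vertex before, between or after the
  two; with coinciding points its orientation would be 0.\<close>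

lemma polygon_vertex_inj:
  assumes "i \<in> {1..m}" "j \<in> {1..m}" "i < j"
  shows "P i \<noteq> P j"
proof
  assume eq: "P i = P j"
  have "3 \<le> m" using P by (simp add: convex_polygon_def)
  then consider "1 < i" | "i < Suc i \<and> Suc i < j" | "j < m" using assms by force
  then show False
    using polygon_orient[of 1 i j] polygon_orient[of i "Suc i" j] polygon_orient[of i j m] assms eq
    by cases (auto simp: orient_degenerate)
qed

lemma hulls_disjoint_if_noncrossing:
  assumes A: "A \<subseteq> {1..m}" and B: "B \<subseteq> {1..m}" and "A \<inter> B = {}"
    and nc: "\<not> crossing A B" "\<not> crossing B A"
  shows "convex hull (P ` A) \<inter> convex hull (P ` B) = {}"
proof -
  consider "A = {}" | "B = {}" | s t where "s \<in> A" "t \<in> A" "s < t" | s t where "s \<in> B" "t \<in> B" "s < t"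
    | a b where "A = {a}" "B = {b}"
  proof -
    have "\<exists>a. A = {a}" if "A \<noteq> {}" "\<And>s t. s \<in> A \<Longrightarrow> t \<in> A \<Longrightarrow> \<not> s < t" for A :: "nat set"
      using that by (metis all_not_in_conv insertI1 insertI2 linorder_neqE_nat singletonD subsetI subset_singletonD)
    then show ?thesis using that by metis
  qed
  then show ?thesis
  proof cases
    case 3
    then show ?thesis using hulls_disjoint_if_noncrossing_aux[OF A B] assms by blast
  next
    case 4
    then show ?thesis using hulls_disjoint_if_noncrossing_aux[OF B A] assms by blast
  next
    case 5
    then have "a \<noteq> b" using assms by auto
    then have "P a \<noteq> P b" using polygon_vertex_inj[of a b] polygon_vertex_inj[of b a] 5 A B
      by (cases a b rule: linorder_cases) auto
    then show ?thesis using 5 by simp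
  qed auto
qed

text \<open>Disjointness of hulls becomes the absence of both crossing patterns. Thus the
  noncrossing partitions do not depend on the shape of the polygon, and what follows is purely
  combinatorial.\<close>

lemma NC_eq: "NC m P = {\<pi>. partition_on {1..m} \<pi> \<and> noncrossing \<pi>}"
proof -
  have *: "convex hull (P ` A) \<inter> convex hull (P ` B) = {} \<longleftrightarrow> \<not> crossing A B \<and> \<not> crossing B A"
    if "partition_on {1..m} \<pi>" "A \<in> \<pi>" "B \<in> \<pi>" "A \<noteq> B" for \<pi> A B
  proof -
    have "A \<subseteq> {1..m}" "B \<subseteq> {1..m}" using partition_onD1[OF that(1)] that(2,3) by blast+
    moreover have "A \<inter> B = {}" using partition_onD2[OF that(1)] that(2-4) by (simp add: disjointD)
    ultimately show ?thesis
      using hulls_intersect_if_crossing[of A B] hulls_intersect_if_crossing[of B A]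
        hulls_disjoint_if_noncrossing[of A B] by (auto simp: Int_commute)
  qed
  have "(\<forall>A\<in>\<pi>. \<forall>B\<in>\<pi>. A \<noteq> B \<longrightarrow> convex hull (P ` A) \<inter> convex hull (P ` B) = {}) \<longleftrightarrow> noncrossing \<pi>"
    if "partition_on {1..m} \<pi>" for \<pi>
    unfolding noncrossing_def using *[OF that] by (simp add: cong: ball_cong) metis
  then show ?thesis unfolding NC_def by (simp cong: conj_cong)
qed

end

section \<open>A poset of noncrossing partitions\<close>

declare One_nat_def [simp del]

definition nc_partitions :: "nat \<Rightarrow> nat set set set" where
  "nc_partitions m = {\<pi>. partition_on {1..m} \<pi> \<and> noncrossing \<pi>}"

definition meet :: "'a set set \<Rightarrow> 'a set set \<Rightarrow> 'a set set" where
  "meet \<pi> \<rho> = {A \<inter> B | A B. A \<in> \<pi> \<and> B \<in> \<rho>} - {{}}"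

lemma meetI: "A \<in> \<pi> \<Longrightarrow> B \<in> \<rho> \<Longrightarrow> A \<inter> B \<noteq> {} \<Longrightarrow> A \<inter> B \<in> meet \<pi> \<rho>"
  by (auto simp: meet_def)

lemma meetE:
  assumes "C \<in> meet \<pi> \<rho>"
  obtains A B where "A \<in> \<pi>" "B \<in> \<rho>" "C = A \<inter> B" "C \<noteq> {}"
  using assms by (auto simp: meet_def)

lemma partition_on_block_eq:
  "partition_on S \<pi> \<Longrightarrow> A \<in> \<pi> \<Longrightarrow> B \<in> \<pi> \<Longrightarrow> v \<in> A \<Longrightarrow> v \<in> B \<Longrightarrow> A = B"
  using partition_onD2[of S \<pi>] by (auto dest: disjointD)

lemma partition_on_meet:
  assumes "partition_on S \<pi>" "partition_on S \<rho>"
  shows "partition_on S (meet \<pi> \<rho>)"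
proof (rule partition_onI)
  have "\<Union>\<pi> = S" "\<Union>\<rho> = S" using assms by (simp_all add: partition_on_def)
  then show "\<Union>(meet \<pi> \<rho>) = S" unfolding meet_def by blast
  fix p q assume pq: "p \<in> meet \<pi> \<rho>" "q \<in> meet \<pi> \<rho>" "p \<noteq> q"
  obtain A B where A: "A \<in> \<pi>" "B \<in> \<rho>" "p = A \<inter> B" using pq(1) by (rule meetE)
  obtain A' B' where A': "A' \<in> \<pi>" "B' \<in> \<rho>" "q = A' \<inter> B'" using pq(2) by (rule meetE)
  show "disjnt p q"
  proof (rule ccontr)
    assume "\<not> disjnt p q"
    then obtain v where "v \<in> A" "v \<in> B" "v \<in> A'" "v \<in> B'" using A A' by (auto simp: disjnt_iff)
    then have "A = A'" "B = B'" using partition_on_block_eq assms A A' by metis+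
    then show False using A A' pq by simp
  qed
qed (simp add: meet_def)

lemma refines_meet1: "partition_on S \<pi> \<Longrightarrow> partition_on S \<rho> \<Longrightarrow> refines S (meet \<pi> \<rho>) \<pi>"
  unfolding refines_def using partition_on_meet by (fastforce elim: meetE)

lemma refines_meet2: "partition_on S \<pi> \<Longrightarrow> partition_on S \<rho> \<Longrightarrow> refines S (meet \<pi> \<rho>) \<rho>"
  unfolding refines_def using partition_on_meet by (fastforce elim: meetE)

lemma refines_meetI:
  assumes "refines S \<tau> \<pi>" "refines S \<tau> \<rho>"
  shows "refines S \<tau> (meet \<pi> \<rho>)"
proof -
  have p: "partition_on S \<tau>" "partition_on S \<pi>" "partition_on S \<rho>"
    using assms by (auto simp: refines_def)
  have "\<exists>Y\<in>meet \<pi> \<rho>. C \<subseteq> Y" if C: "C \<in> \<tau>" for C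
  proof -
    obtain A B where "A \<in> \<pi>" "C \<subseteq> A" "B \<in> \<rho>" "C \<subseteq> B" using assms C unfolding refines_def by meson
    moreover have "C \<noteq> {}" using C partition_onD3[OF p(1)] by auto
    ultimately show ?thesis using meetI[of A \<pi> B \<rho>] by blast
  qed
  then show ?thesis using p partition_on_meet by (auto simp: refines_def)
qed

lemma crossing_mono: "crossing A B \<Longrightarrow> A \<subseteq> A' \<Longrightarrow> B \<subseteq> B' \<Longrightarrow> crossing A' B'"
  unfolding crossing_def by blast

text \<open>A crossing of two intersections is also a crossing of the blocks containing them, in
  both partitions; so these blocks coincide, and so do the intersections.\<close>

lemma noncrossing_meet:
  assumes "partition_on S \<pi>" "partition_on S \<rho>" "noncrossing \<pi>" "noncrossing \<rho>"
  shows "noncrossing (meet \<pi> \<rho>)"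
  unfolding noncrossing_def
proof (intro ballI impI notI)
  fix p q assume pq: "p \<in> meet \<pi> \<rho>" "q \<in> meet \<pi> \<rho>" "p \<noteq> q" "crossing p q"
  obtain A B where A: "A \<in> \<pi>" "B \<in> \<rho>" "p = A \<inter> B" using pq(1) by (rule meetE)
  obtain A' B' where A': "A' \<in> \<pi>" "B' \<in> \<rho>" "q = A' \<inter> B'" using pq(2) by (rule meetE)
  have "crossing A A'" "crossing B B'"
    using pq(4) A A' by (auto intro: crossing_mono)
  then have "A = A'" "B = B'" using assms(3,4) A(1,2) A'(1,2) unfolding noncrossing_def by metis+
  then show False using A A' pq(3) by simp
qed

lemma meet_nc_partitions:
  "\<pi> \<in> nc_partitions m \<Longrightarrow> \<rho> \<in> nc_partitions m \<Longrightarrow> meet \<pi> \<rho> \<in> nc_partitions m"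
  using noncrossing_meet partition_on_meet unfolding nc_partitions_def by blast

lemma finite_nc_partitions: "finite (nc_partitions m)"
proof (rule finite_subset)
  show "nc_partitions m \<subseteq> Pow (Pow {1..m})"
    by (auto simp: nc_partitions_def partition_on_def)
qed simp

lemma nc_partitionsD:
  assumes "\<pi> \<in> nc_partitions m"
  shows "partition_on {1..m} \<pi>" "noncrossing \<pi>"
  using assms by (auto simp: nc_partitions_def)

lemma nc_block:
  assumes "\<pi> \<in> nc_partitions m" "B \<in> \<pi>"
  shows "finite B" "B \<noteq> {}" "B \<subseteq> {1..m}" "Max B \<in> B" "Max B \<in> {1..m}" "Min B \<in> B"
proof -
  show B: "B \<subseteq> {1..m}" using assms partition_onD1[OF nc_partitionsD(1)] by blast
  then show fin: "finite B" using finite_subset by blast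
  show ne: "B \<noteq> {}" using assms partition_onD3[OF nc_partitionsD(1)] by blast
  show "Max B \<in> B" "Min B \<in> B" using fin ne by auto
  then show "Max B \<in> {1..m}" using B by blast
qed

lemma nc_block_exists:
  assumes "\<pi> \<in> nc_partitions m" "v \<in> {1..m}"
  obtains B where "B \<in> \<pi>" "v \<in> B"
  using assms partition_onD1[OF nc_partitionsD(1)] by blast

lemma nc_block_eq:
  "\<pi> \<in> nc_partitions m \<Longrightarrow> A \<in> \<pi> \<Longrightarrow> B \<in> \<pi> \<Longrightarrow> v \<in> A \<Longrightarrow> v \<in> B \<Longrightarrow> A = B"
  using partition_on_block_eq nc_partitionsD(1) by metis

lemma nc_not_crossing:
  "\<pi> \<in> nc_partitions m \<Longrightarrow> A \<in> \<pi> \<Longrightarrow> B \<in> \<pi> \<Longrightarrow> A \<noteq> B \<Longrightarrow> \<not> crossing A B"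
  using nc_partitionsD(2) unfolding noncrossing_def by blast

lemma refines_block:
  assumes "refines S x y" "A \<in> x"
  obtains B where "B \<in> y" "A \<subseteq> B"
  using assms by (auto simp: refines_def)

lemma refines_block_subset:
  assumes "refines S x y" "A \<in> x" "B \<in> y" "v \<in> A" "v \<in> B"
  shows "A \<subseteq> B"
proof -
  obtain C where "C \<in> y" "A \<subseteq> C" using refines_block[OF assms(1,2)] .
  then show ?thesis using partition_on_block_eq[of S y C B v] assms by (auto simp: refines_def)
qed

section \<open>Tame partitions and the order \<open>le\<close>\<close>

locale parking_space =
  fixes m k :: nat
  assumes k: "1 < k" "k < m"
begin

text \<open>Along a maximal chain every vertex \<open>v < m\<close> ceases exactly once to be the maximum of its block,
  and the minimum of that block is then a label. In a \<open>tame\<close> chain this happens to \<open>v > k\<close> while \<open>{v}\<close>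
  is a block, which yields the label \<open>v\<close>. The label \<open>k\<close> is avoided if the chain visits \<open>mid\<close>: the
  relation \<open>le\<close> forbids to jump from \<open>low\<close> to \<open>high\<close> past \<open>mid\<close>.\<close>

definition tame :: "nat set set set" where
  "tame = {\<pi> \<in> nc_partitions m. \<forall>B\<in>\<pi>. k < Max B \<longrightarrow> Max B < m \<longrightarrow> B = {Max B}}"

definition mid :: "nat set set set" where
  "mid = {\<pi> \<in> tame. \<exists>B\<in>\<pi>. Max B = k \<and> B \<noteq> {k}}"

definition low :: "nat set set \<Rightarrow> bool" where
  "low \<pi> \<longleftrightarrow> {k} \<in> \<pi>"

definition high :: "nat set set \<Rightarrow> bool" where
  "high \<pi> \<longleftrightarrow> (\<exists>B\<in>\<pi>. k \<in> B \<and> m \<in> B)"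

definition proper :: "nat set set set" where
  "proper = tame - {NC_min m, NC_max m}"

definition le :: "nat set set \<Rightarrow> nat set set \<Rightarrow> bool" where
  "le x y \<longleftrightarrow> refines {1..m} x y \<and>
     (low x \<longrightarrow> high y \<longrightarrow> (\<exists>z\<in>mid. refines {1..m} x z \<and> refines {1..m} z y))"

text \<open>Together with \<open>lower_part\<close> these are the proper tame partitions comparable
  with some member of \<open>mid\<close>. They are separated by whether \<open>{k}\<close> is a
  block; \<open>mid\<close> itself belongs to \<open>upper_part\<close>.\<close>

definition upper_part :: "nat set set set" where
  "upper_part = {y \<in> proper. \<exists>z\<in>mid. refines {1..m} z y}"

definition lower_part :: "nat set set set" where
  "lower_part = {x \<in> proper. low x \<and> (\<exists>z\<in>mid. refines {1..m} x z)}"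

lemma tame_nc: "\<pi> \<in> tame \<Longrightarrow> \<pi> \<in> nc_partitions m"
  by (simp add: tame_def)

lemma mid_tame: "\<pi> \<in> mid \<Longrightarrow> \<pi> \<in> tame"
  by (simp add: mid_def)

lemma proper_tame: "\<pi> \<in> proper \<Longrightarrow> \<pi> \<in> tame"
  by (simp add: proper_def)

lemma tame_partition: "\<pi> \<in> tame \<Longrightarrow> partition_on {1..m} \<pi>"
  using tame_nc nc_partitionsD(1) by blast

lemma mid_block:
  assumes "\<pi> \<in> mid"
  obtains B where "B \<in> \<pi>" "k \<in> B" "Max B = k" "B \<noteq> {k}" "B \<subseteq> {1..k}"
proof -
  obtain B where B: "B \<in> \<pi>" "Max B = k" "B \<noteq> {k}" using assms by (auto simp: mid_def)
  then have "k \<in> B" "B \<subseteq> {1..k}"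
    using nc_block[OF tame_nc[OF mid_tame[OF assms]], of B] Max_ge[of B] by force+
  then show ?thesis using B that by blast
qed

lemma mid_not_low: "\<pi> \<in> mid \<Longrightarrow> \<not> low \<pi>"
  by (metis low_def mid_block nc_block_eq tame_nc mid_tame singletonI)

lemma mid_not_high:
  assumes "\<pi> \<in> mid"
  shows "\<not> high \<pi>"
proof
  assume "high \<pi>"
  then obtain A where "A \<in> \<pi>" "k \<in> A" "m \<in> A" by (auto simp: high_def)
  moreover obtain B where "B \<in> \<pi>" "k \<in> B" "B \<subseteq> {1..k}" using mid_block[OF assms] .
  ultimately have "m \<in> {1..k}" using nc_block_eq tame_nc mid_tame assms by blast
  then show False using k by simp
qed

lemma low_not_high: "\<pi> \<in> tame \<Longrightarrow> low \<pi> \<Longrightarrow> \<not> high \<pi>"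
  using nc_block_eq[OF tame_nc] k unfolding low_def high_def by fastforce

text \<open>The maximum of the block of \<open>k\<close> is \<open>k\<close> or \<open>m\<close>: a
  maximum strictly between would make the block a singleton not containing \<open>k\<close>.\<close>

lemma tame_cases:
  assumes "\<pi> \<in> tame"
  obtains "low \<pi>" | "\<pi> \<in> mid" | "high \<pi>"
proof -
  obtain B where B: "B \<in> \<pi>" "k \<in> B" using nc_block_exists[OF tame_nc[OF assms], of k] k by auto
  note nB = nc_block[OF tame_nc[OF assms] B(1)]
  have "k \<le> Max B" using nB B by simp
  then consider "B = {k}" | "B \<noteq> {k}" "Max B = k" | "k < Max B" "Max B < m" | "Max B = m"
    using nB(5) by fastforce
  then show ?thesis
  proof cases
    case 3
    then have "B = {Max B}" using assms B by (auto simp: tame_def)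
    then show ?thesis using 3 B by (metis less_irrefl singletonD)
  qed (use that assms B nB in \<open>auto simp: low_def mid_def high_def\<close>)
qed

lemma mid_proper: "mid \<subseteq> proper"
proof
  fix z assume z: "z \<in> mid"
  then obtain B where B: "B \<in> z" "B \<noteq> {k}" "Max B = k" "k \<in> B" "B \<subseteq> {1..k}" by (rule mid_block)
  have "m \<notin> B" using B k by auto
  have "B \<notin> NC_min m" using B by (auto simp: NC_min_def)
  moreover have "B \<notin> NC_max m" using \<open>m \<notin> B\<close> k by (auto simp: NC_max_def)
  ultimately show "z \<in> proper" using z B(1) by (auto simp: proper_def mid_tame)
qed

lemma refines_low: 
  assumes "refines {1..m} x y" "low y" "x \<in> nc_partitions m"
  shows "low x"
proof -
  obtain A where A: "A \<in> x" "k \<in> A" using nc_block_exists[OF assms(3), of k] k by auto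
  then have "A \<subseteq> {k}" using refines_block_subset[OF assms(1) A(1), of "{k}" k] assms(2) by (auto simp: low_def)
  then have "A = {k}" using A by auto
  then show ?thesis using A by (simp add: low_def)
qed

lemma refines_high: "refines {1..m} x y \<Longrightarrow> high x \<Longrightarrow> high y"
  unfolding high_def by (meson refines_block subsetD)

text \<open>If a block of the meet has its maximum strictly between \<open>k\<close> and
  \<open>m\<close>, the two blocks it comes from cannot both contain \<open>m\<close>. The one
  without \<open>m\<close> has its maximum in the same range and is a singleton by tameness.\<close>

lemma meet_tame:
  assumes "x \<in> tame" "y \<in> tame"
  shows "meet x y \<in> tame"
proof -
  have "B = {Max B}" if B: "B \<in> meet x y" "k < Max B" "Max B < m" for B
  proof -
    have nc: "meet x y \<in> nc_partitions m" using assms meet_nc_partitions tame_nc by blast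
    obtain X Y where XY: "X \<in> x" "Y \<in> y" "B = X \<inter> Y" using B(1) by (rule meetE)
    note nB = nc_block[OF nc B(1)] and nX = nc_block[OF tame_nc[OF assms(1)] XY(1)] 
      and nY = nc_block[OF tame_nc[OF assms(2)] XY(2)]
    have *: "X = {Max X}" if "Max X < m"
      using assms(1) XY(1) that B(2) nB(4) Max_ge[OF nX(1), of "Max B"] XY(3) by (auto simp: tame_def)
    have **: "Y = {Max Y}" if "Max Y < m"
      using assms(2) XY(2) that B(2) nB(4) Max_ge[OF nY(1), of "Max B"] XY(3) by (auto simp: tame_def)
    have "Max X < m \<or> Max Y < m"
    proof (rule ccontr)
      assume "\<not> ?thesis"
      then have "Max X = m" "Max Y = m" using nX(5) nY(5) by auto
      then have "m \<in> B" using nX(4) nY(4) XY by auto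
      then show False using B(3) Max_ge[OF nB(1)] by force
    qed
    then have "B \<subseteq> {Max X} \<or> B \<subseteq> {Max Y}" using * ** XY(3) by blast
    then have "\<exists>w. B = {w}" using nB(2) by blast
    then show ?thesis using nB(4) by auto
  qed
  then show ?thesis using assms by (simp add: tame_def meet_nc_partitions)
qed

text \<open>The block of \<open>k\<close> in \<open>q\<close> caps the intersection at
  \<open>k\<close>, and the common vertex \<open>v\<close> keeps it from shrinking to
  \<open>{k}\<close>.\<close>

lemma meet_mid:
  assumes y: "y \<in> tame" and q: "q \<in> mid"
    and Y: "Y \<in> y" "v \<in> Y" "k \<in> Y" and S: "S \<in> q" "v \<in> S" "k \<in> S" and "v \<noteq> k"
  shows "meet y q \<in> mid"
proof -
  obtain S' where "S' \<in> q" "k \<in> S'" "S' \<subseteq> {1..k}" using q by (rule mid_block)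
  then have Sk: "S \<subseteq> {1..k}" using nc_block_eq[OF tame_nc[OF mid_tame[OF q]] S(1) _ S(3)] by metis
  have "Y \<inter> S \<in> meet y q" using meetI[of Y y S q] Y S by blast
  moreover have "Max (Y \<inter> S) = k"
    using Sk Y S by (intro Max_eqI) (auto intro: finite_subset)
  moreover have "Y \<inter> S \<noteq> {k}" using Y S \<open>v \<noteq> k\<close> by blast
  ultimately show ?thesis using meet_tame[OF y mid_tame[OF q]] by (auto simp: mid_def)
qed

lemma mid_upper_part: "mid \<subseteq> upper_part"
  using mid_proper mid_tame tame_partition refines_refl by (fastforce simp: upper_part_def)

lemma upper_not_low: "y \<in> upper_part \<Longrightarrow> \<not> low y"
  unfolding upper_part_def using refines_low mid_not_low mid_tame tame_nc by blast

lemma upper_tame: "y \<in> upper_part \<Longrightarrow> y \<in> tame"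
  by (simp add: upper_part_def proper_def)

lemma le_refinesI: "refines {1..m} x y \<Longrightarrow> \<not> low x \<or> \<not> high y \<Longrightarrow> le x y"
  by (auto simp: le_def)

text \<open>Only transitivity from a \<open>low\<close> element to a \<open>high\<close> one is
  delicate. The trichotomy for the middle element \<open>y\<close> provides the member of
  \<open>mid\<close>: \<open>y\<close> itself, or the witness for the step after a
  \<open>low\<close> \<open>y\<close>, or the witness for the step before a \<open>high\<close>
  \<open>y\<close>.\<close>

lemma finite_poset_le: "finite_poset (upper_part \<union> lower_part) le"
proof -
  have sub: "upper_part \<union> lower_part \<subseteq> tame" by (auto simp: upper_part_def lower_part_def proper_def)
  have tr: "le x z" if xyz: "x \<in> tame" "y \<in> tame" "z \<in> tame" "le x y" "le y z" for x y z
  proof -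
    have r: "refines {1..m} x y" "refines {1..m} y z" using xyz by (auto simp: le_def)
    have "\<exists>w\<in>mid. refines {1..m} x w \<and> refines {1..m} w z" if lh: "low x" "high z"
      using xyz(2)
    proof (cases rule: tame_cases)
      case 1
      then obtain w where "w \<in> mid" "refines {1..m} y w" "refines {1..m} w z"
        using lh xyz unfolding le_def by blast
      then show ?thesis using r refines_trans by blast
    next
      case 2
      then show ?thesis using r by blast
    next
      case 3
      then obtain w where "w \<in> mid" "refines {1..m} x w" "refines {1..m} w y"
        using lh xyz unfolding le_def by blast
      then show ?thesis using r refines_trans by blast
    qed
    then show ?thesis using r refines_trans by (auto simp: le_def)
  qed
  have rf: "le x x" if "x \<in> tame" for x
    using that low_not_high refines_refl tame_partition by (auto simp: le_def)
  have "finite (upper_part \<union> lower_part)"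
    using sub finite_nc_partitions[of m] tame_nc by (meson finite_subset subsetI)
  show ?thesis
  proof (unfold_locales, goal_cases)
    case 1
    show ?case by fact
  next
    show "x = y" if "le x y" "le y x" for x y
      using that refines_asym unfolding le_def by blast
    show "le x x" if "x \<in> upper_part \<union> lower_part" for x using rf sub that by blast
    show "le x z" if "x \<in> upper_part \<union> lower_part" "y \<in> upper_part \<union> lower_part"
      "z \<in> upper_part \<union> lower_part" "le x y" "le y z" for x y z 
      by (rule tr[of x y z]) (use sub that in blast)+
  qed
qed

definition bottom_block :: "nat set set" where
  "bottom_block = insert {1..k} ((\<lambda>v. {v}) ` {k<..m})"

lemma bottom_block_mid: "bottom_block \<in> mid"
proof -
  have "partition_on {1..m} bottom_block"
    unfolding bottom_block_def using k
    by (intro partition_onI) (auto simp: disjnt_def)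
  moreover have "noncrossing bottom_block"
    by (auto simp: noncrossing_def bottom_block_def crossing_def)
  moreover have "Max {1..k} = k" using k by (intro Max_eqI) auto
  ultimately have "bottom_block \<in> tame"
    using k by (auto simp: tame_def nc_partitions_def bottom_block_def)
  moreover have "{1..k} \<noteq> {k}"
  proof
    assume "{1..k} = {k}"
    moreover have "1 \<in> {1..k}" using k by simp
    ultimately show False using k by simp
  qed
  ultimately show ?thesis using \<open>Max {1..k} = k\<close> by (auto simp: mid_def bottom_block_def)
qed

text \<open>Every \<open>y\<close> here lies above some member of \<open>mid\<close>, whose block of
  \<open>k\<close> is inside \<open>{1..k}\<close> and contributes the second vertex for
  \<open>meet_mid\<close>. Nothing in \<open>upper_part\<close> is \<open>low\<close>, so
  \<open>le\<close> is refinement.\<close>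

lemma contractible_upper_part: "contractible_complex (order_complex upper_part le)"
proof -
  interpret finite_poset upper_part le
    by (rule finite_poset.subposet[OF finite_poset_le]) simp
  show ?thesis
  proof (rule contractible_if_meets[where q=bottom_block and f="\<lambda>y. meet y bottom_block"])
    show "bottom_block \<in> upper_part" using bottom_block_mid mid_upper_part by blast
  next
    fix y assume y: "y \<in> upper_part"
    then obtain z where z: "z \<in> mid" "refines {1..m} z y" by (auto simp: upper_part_def)
    obtain B where B: "B \<in> z" "k \<in> B" "B \<noteq> {k}" "B \<subseteq> {1..k}" using z(1) by (rule mid_block)
    obtain v where v: "v \<in> B" "v \<noteq> k" using B by blast
    obtain Y where Y: "Y \<in> y" "B \<subseteq> Y" using refines_block[OF z(2) B(1)] .
    have "meet y bottom_block \<in> mid"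
      by (rule meet_mid[OF upper_tame[OF y] bottom_block_mid Y(1), where v=v and S="{1..k}"])
        (use Y B v k in \<open>auto simp: bottom_block_def\<close>)
    moreover have "partition_on {1..m} y" "partition_on {1..m} bottom_block"
      using y upper_tame tame_partition bottom_block_mid mid_tame by auto
    ultimately show "meet y bottom_block \<in> upper_part \<and> le (meet y bottom_block) y \<and>
        le (meet y bottom_block) bottom_block"
      using mid_not_low mid_upper_part by (auto intro!: le_refinesI refines_meet1 refines_meet2)
  next
    fix y z assume "z \<in> upper_part" "le z y" "le z bottom_block"
    then show "le z (meet y bottom_block)"
      using upper_not_low by (auto intro!: le_refinesI refines_meetI simp: le_def)
  qed
qed

text \<open>The part of \<open>{1..k}\<close> that can be joined to \<open>k\<close> without crossing the block of \<open>m\<close>.\<close>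

definition visible :: "nat set set \<Rightarrow> nat set" where
  "visible x = {v \<in> {1..k}. \<forall>D\<in>x. m \<in> D \<longrightarrow> (\<forall>u\<in>D. u < k \<longrightarrow> u < v)}"

text \<open>\<open>visible x\<close> is an interval ending at \<open>k\<close>, which is why it does
  not cross its complement.\<close>

definition split_visible :: "nat set set \<Rightarrow> nat set set" where
  "split_visible x = {visible x, {1..m} - visible x}"

text \<open>A vertex \<open>v\<close> of \<open>B\<close> below some \<open>u < k\<close> in the
  block of \<open>m\<close> would give the crossing \<open>v < u < k < m\<close>.\<close>

lemma mid_block_visible:
  assumes z: "z \<in> mid" "refines {1..m} x z" and B: "B \<in> z" "k \<in> B"
  shows "B \<subseteq> visible x"
proof
  fix v assume v: "v \<in> B"
  note nc = tame_nc[OF mid_tame[OF z(1)]]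
  obtain B' where "B' \<in> z" "k \<in> B'" "B' \<subseteq> {1..k}" using z(1) by (rule mid_block)
  then have Bk: "B \<subseteq> {1..k}" using nc_block_eq[OF nc B(1) _ B(2)] by metis
  have "u < v" if D: "D \<in> x" "m \<in> D" and u: "u \<in> D" "u < k" for D u
  proof (rule ccontr)
    assume "\<not> u < v"
    obtain D' where D': "D' \<in> z" "D \<subseteq> D'" using refines_block[OF z(2) D(1)] .
    have "B \<noteq> D'" using D D' Bk k by auto
    then have "u \<noteq> v" using nc_block_eq[OF nc B(1) D'(1)] v u D' by blast
    then have "crossing B D'" using \<open>\<not> u < v\<close> v u D D' B k by (intro crossingI[of v _ u _ k m]) auto
    then show False using nc_not_crossing[OF nc B(1) D'(1) \<open>B \<noteq> D'\<close>] by blast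
  qed
  then show "v \<in> visible x" using v Bk by (auto simp: visible_def)
qed

lemma split_visible_mid:
  assumes x: "x \<in> lower_part"
  shows "split_visible x \<in> mid" "refines {1..m} x (split_visible x)"
proof -
  let ?S = "visible x"
  obtain z where z: "z \<in> mid" "refines {1..m} x z" using x by (auto simp: lower_part_def)
  obtain B where B: "B \<in> z" "k \<in> B" "B \<noteq> {k}" using z(1) by (rule mid_block)
  have BS: "B \<subseteq> ?S" using mid_block_visible[OF z B(1,2)] .
  have Sk: "?S \<subseteq> {1..k}" by (auto simp: visible_def)
  have kS: "k \<in> ?S" using BS B by blast
  have mS: "m \<in> {1..m} - ?S" using Sk k by auto
  have xt: "x \<in> tame" and low: "low x" using x by (auto simp: lower_part_def proper_def)
  have up: "w \<in> ?S" if "v \<in> ?S" "v \<le> w" "w \<le> k" for v w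
    using that by (force simp: visible_def)
  have part: "partition_on {1..m} (split_visible x)"
  proof (rule partition_onI)
    show "\<Union>(split_visible x) = {1..m}"
      using Sk k by (auto simp: split_visible_def)
    show "{} \<notin> split_visible x" using kS mS unfolding split_visible_def by blast
  qed (auto simp: split_visible_def disjnt_def)
  have gap: "w \<in> ?S" if "v \<in> ?S" "u \<in> ?S" "v < w" "w < u" for u v w
    using up[of v w] that Sk by force
  have "\<not> crossing ?S ({1..m} - ?S)"
    using gap unfolding crossing_def by blast
  moreover have "\<not> crossing ({1..m} - ?S) ?S"
    using gap unfolding crossing_def by blast
  ultimately have "split_visible x \<in> nc_partitions m"
    using part by (auto simp: nc_partitions_def noncrossing_def split_visible_def)
  moreover have MS: "Max ?S = k" using Sk kS by (intro Max_eqI) (auto intro: finite_subset)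
  moreover have "Max ({1..m} - ?S) = m" using mS by (intro Max_eqI) auto
  ultimately have "split_visible x \<in> tame" by (auto simp: tame_def split_visible_def)
  moreover have "?S \<noteq> {k}" using BS B by auto
  ultimately show "split_visible x \<in> mid" using MS by (auto simp: mid_def split_visible_def)
  obtain D where D: "D \<in> x" "m \<in> D" using nc_block_exists[OF tame_nc[OF xt], of m] k by auto
  have kD: "k \<notin> D" using low_not_high[OF xt low] D by (auto simp: high_def)
  \<comment> \<open>A block \<open>A\<close> with vertices both in and outside the interval is shown
    to cross the block \<open>D\<close> of \<open>m\<close>. Note that \<open>D\<close> itself
    avoids the interval, because it does not contain \<open>k\<close>.\<close>
  have "A \<subseteq> ?S \<or> A \<subseteq> {1..m} - ?S" if A: "A \<in> x" for A
  proof (rule ccontr)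
    assume neg: "\<not> ?thesis"
    note nA = nc_block[OF tame_nc[OF xt] A]
    obtain a b where ab: "a \<in> A" "a \<in> ?S" "b \<in> A" "b \<notin> ?S" using neg nA(3) by blast
    have "A \<noteq> D"
    proof
      assume "A = D"
      then have "a < k" using ab kD Sk by (metis atLeastAtMost_iff le_neq_implies_less subsetD)
      then have "a < a" using ab D \<open>A = D\<close> by (auto simp: visible_def)
      then show False by simp
    qed
    then have "m \<notin> A" using nc_block_eq[OF tame_nc[OF xt] A D(1)] D by blast
    then have "Max A < m" using nA(4,5) by (metis atLeastAtMost_iff le_neq_implies_less)
    \<comment> \<open>Tameness ensures that \<open>b\<close> is outside \<open>visible x\<close> not
      because it exceeds \<open>k\<close>, but because some \<open>u < k\<close> in \<open>D\<close>
      is at least \<open>b\<close>.\<close>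
    have "Max A \<le> k"
    proof (rule ccontr)
      assume "\<not> Max A \<le> k"
      then have "A = {Max A}" using xt A \<open>Max A < m\<close> by (auto simp: tame_def)
      then show False using ab by (metis singletonD)
    qed
    then have "b \<le> k" using Max_ge[OF nA(1) ab(3)] by linarith
    then obtain D' u where u: "D' \<in> x" "m \<in> D'" "u \<in> D'" "u < k" "b \<le> u"
      using ab(3,4) nA(3) by (auto simp: visible_def not_less)
    then have "D' = D" using nc_block_eq[OF tame_nc[OF xt] D(1)] D by metis
    then have uD: "u \<in> D" using u by simp
    have "b \<noteq> u" using uD ab nc_block_eq[OF tame_nc[OF xt] A D(1)] \<open>A \<noteq> D\<close> by blast
    moreover have "u < a" using ab(2) u by (auto simp: visible_def)
    moreover have "a < m" using ab(2) Sk k by auto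
    ultimately have "crossing A D" using ab uD D u by (intro crossingI[of b _ u _ a m]) auto
    then show False using nc_not_crossing[OF tame_nc[OF xt] A D(1) \<open>A \<noteq> D\<close>] by blast
  qed
  then show "refines {1..m} x (split_visible x)"
    using part tame_partition[OF xt] by (auto simp: refines_def split_visible_def)
qed

text \<open>For \<open>y\<close> above \<open>x\<close>, a member \<open>z\<close> of
  \<open>mid\<close> lies between them. Its block of \<open>k\<close> is contained in
  \<open>visible x\<close> and in a block of \<open>y\<close>, so the meet of \<open>y\<close> with
  \<open>split_visible x\<close> is again in \<open>mid\<close> and above \<open>x\<close>.\<close>

lemma contractible_chains: "contractible_complex (order_complex (upper_part \<union> lower_part) le)"
proof (rule contractible_if_removable[where q=split_visible and f="\<lambda>x y. meet y (split_visible x)"])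
  show "upper_part \<inter> lower_part = {}" using upper_not_low by (auto simp: lower_part_def)
  show "split_visible x \<in> upper_part \<and> le x (split_visible x)" if "x \<in> lower_part" for x
    using split_visible_mid[OF that] mid_upper_part mid_not_high by (auto intro: le_refinesI)
next
  fix x y assume x: "x \<in> lower_part" and y: "y \<in> upper_part" "le x y"
  note q = split_visible_mid[OF x]
  \<comment> \<open>This is where \<open>le\<close> is stronger than refinement: for a
    \<open>high\<close> \<open>y\<close> the intermediate member of \<open>mid\<close> is part of
    \<open>le x y\<close>.\<close>
  have "\<exists>z\<in>mid. refines {1..m} x z \<and> refines {1..m} z y"
    using upper_tame[OF y(1)]
  proof (cases rule: tame_cases)
    case 2
    then show ?thesis using y refines_refl tame_partition mid_tame unfolding le_def by blast
  next
    case 3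
    then show ?thesis using x y unfolding le_def lower_part_def by blast
  qed (use y upper_not_low in blast)
  then obtain z where z: "z \<in> mid" "refines {1..m} x z" "refines {1..m} z y" by blast
  obtain B where B: "B \<in> z" "k \<in> B" "B \<noteq> {k}" "B \<subseteq> {1..k}" using z(1) by (rule mid_block)
  obtain v where v: "v \<in> B" "v \<noteq> k" using B by blast
  obtain Y where Y: "Y \<in> y" "B \<subseteq> Y" using refines_block[OF z(3) B(1)] .
  have m: "meet y (split_visible x) \<in> mid"
    by (rule meet_mid[OF upper_tame[OF y(1)] q(1) Y(1), where v=v and S="visible x"])
      (use Y B v mid_block_visible[OF z(1,2) B(1,2)] in \<open>auto simp: split_visible_def\<close>)
  moreover have "partition_on {1..m} y" "partition_on {1..m} (split_visible x)"
    using y upper_tame tame_partition q mid_tame by auto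
  moreover have "refines {1..m} x (meet y (split_visible x))"
    using y q by (auto intro: refines_meetI simp: le_def)
  ultimately show "meet y (split_visible x) \<in> upper_part \<and> le x (meet y (split_visible x)) \<and>
      le (meet y (split_visible x)) y \<and> le (meet y (split_visible x)) (split_visible x)"
    using mid_not_low[OF m] mid_not_high[OF m] mid_upper_part
    by (auto intro!: le_refinesI refines_meet1 refines_meet2)
next
  fix x y z assume "z \<in> upper_part" "le z y" "le z (split_visible x)"
  then show "le z (meet y (split_visible x))"
    using upper_not_low by (auto intro!: le_refinesI refines_meetI simp: le_def)
qed (use finite_poset_le contractible_upper_part in auto)

end

section \<open>Labels of maximal chains\<close>

lemma next_vertexI1:
  assumes "finite B" "w \<in> B" "v < w" "\<And>u. u \<in> B \<Longrightarrow> v < u \<Longrightarrow> w \<le> u"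
  shows "next_vertex B v = w"
proof -
  have "Min {w \<in> B. v < w} = w" using assms by (intro Min_eqI) auto
  then show ?thesis using assms by (auto simp: next_vertex_def)
qed

lemma next_vertexI2:
  assumes "finite B" "w \<in> B" "\<And>u. u \<in> B \<Longrightarrow> u \<le> v" "\<And>u. u \<in> B \<Longrightarrow> w \<le> u"
  shows "next_vertex B v = w"
proof -
  have "Min B = w" using assms by (intro Min_eqI) auto
  moreover have "\<not> (\<exists>u\<in>B. v < u)" using assms(3) by force
  ultimately show ?thesis by (simp add: next_vertex_def)
qed

lemma next_vertex_cases:
  assumes "finite B" "B \<noteq> {}"
  obtains "next_vertex B v \<in> B" "v < next_vertex B v" "\<And>u. u \<in> B \<Longrightarrow> v < u \<Longrightarrow> next_vertex B v \<le> u"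
  | "next_vertex B v = Min B" "\<And>u. u \<in> B \<Longrightarrow> u \<le> v"
proof (cases "\<exists>w\<in>B. v < w")
  case True
  then have "Min {w\<in>B. v < w} \<in> {w\<in>B. v < w}" using assms(1) by (intro Min_in) auto
  then show ?thesis using True that(1) assms(1) by (auto simp: next_vertex_def)
next
  case False
  then have "next_vertex B v = Min B" by (simp add: next_vertex_def)
  moreover have "u \<le> v" if "u \<in> B" for u using False that by force
  ultimately show ?thesis using that(2) by blast
qed

lemma next_vertex_in: "finite B \<Longrightarrow> B \<noteq> {} \<Longrightarrow> next_vertex B v \<in> B"
  by (rule next_vertex_cases[of B v]) auto

lemma next_vertex_surj:
  assumes "finite B" "v \<in> B"
  obtains u where "u \<in> B" "next_vertex B u = v"
proof (cases "\<exists>u\<in>B. u < v")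
  case True
  let ?u = "Max {u\<in>B. u < v}"
  have "?u \<in> {u\<in>B. u < v}" using True assms by (intro Max_in) auto
  moreover have "v \<le> w" if "w \<in> B" "?u < w" for w
  proof (rule ccontr)
    assume "\<not> v \<le> w"
    then have "w \<le> ?u" using that assms by (intro Max_ge) auto
    then show False using that by simp
  qed
  ultimately have "?u \<in> B" "next_vertex B ?u = v"
    using assms by (auto intro: next_vertexI1)
  then show ?thesis using that by blast
next
  case False
  have "Max B \<in> B" using assms by (intro Max_in) auto
  moreover have "next_vertex B (Max B) = v"
    using False assms by (intro next_vertexI2) (auto simp: not_less)
  ultimately show ?thesis using that by blast
qed

lemma NC_perm_block:
  assumes "\<pi> \<in> nc_partitions m" "B \<in> \<pi>" "v \<in> B"
  shows "NC_perm \<pi> v = next_vertex B v"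
proof -
  have "(THE B. B \<in> \<pi> \<and> v \<in> B) = B"
    using assms(2,3) nc_block_eq[OF assms(1)] by (intro the_equality) blast+
  moreover have "v \<in> \<Union>\<pi>" using assms by blast
  ultimately show ?thesis by (simp add: NC_perm_def)
qed

lemma NC_perm_outside:
  assumes "\<pi> \<in> nc_partitions m" "v \<notin> {1..m}"
  shows "NC_perm \<pi> v = v"
  using assms partition_onD1[OF nc_partitionsD(1)[OF assms(1)]] by (simp add: NC_perm_def)

lemma NC_perm_inv:
  assumes "\<pi> \<in> nc_partitions m"
  shows "NC_perm \<pi> \<circ> inv (NC_perm \<pi>) = id"
proof -
  have "\<exists>u. NC_perm \<pi> u = v" for v
  proof (cases "v \<in> {1..m}")
    case True
    obtain B where B: "B \<in> \<pi>" "v \<in> B" using nc_block_exists[OF assms True] .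
    obtain u where "u \<in> B" "next_vertex B u = v"
      using next_vertex_surj nc_block(1)[OF assms B(1)] B(2) by blast
    then show ?thesis using NC_perm_block[OF assms B(1)] by blast
  next
    case False
    then show ?thesis using NC_perm_outside[OF assms] by blast
  qed
  then have "surj (NC_perm \<pi>)" by (metis surj_def)
  then show ?thesis by (simp add: surj_iff)
qed

text \<open>The blocks are ordered by their maxima: \<open>R\<close> keeps its maximum and
  \<open>B\<close> loses it, so that the step is recorded by \<open>B\<close> alone.\<close>

definition merges :: "nat set set \<Rightarrow> nat set \<Rightarrow> nat set \<Rightarrow> nat set set \<Rightarrow> bool" where
  "merges x B R y \<longleftrightarrow> B \<in> x \<and> R \<in> x \<and> Max B < Max R \<and> y = insert (R \<union> B) (x - {R, B})"

lemma Min_transposition: "a < b \<Longrightarrow> smaller_moved (Transposition.transpose a b) = a"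
proof -
  assume "a < b"
  then have "{v. Transposition.transpose a b v \<noteq> v} = {a, b}" by (auto simp: Transposition.transpose_def)
  then show ?thesis using \<open>a < b\<close> by (simp add: smaller_moved_def)
qed

text \<open>By noncrossing, \<open>B\<close> sits in one cyclic gap of \<open>R\<close>, which ends
  at the first vertex \<open>e\<close> of \<open>R\<close> after \<open>Max B\<close>. The merge
  changes two successors only: \<open>Max B\<close> now goes to \<open>e\<close>, and the vertex of
  \<open>R\<close> that went to \<open>e\<close> now goes to \<open>Min B\<close>. So the quotient
  swaps \<open>Min B\<close> and \<open>e\<close>, and \<open>Min B < e\<close>.\<close>

lemma merge_label:
  assumes x: "x \<in> nc_partitions m" and y: "y \<in> nc_partitions m" and xy: "merges x B R y"
  shows "smaller_moved (NC_perm y \<circ> inv (NC_perm x)) = Min B"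
proof -
  have B: "B \<in> x" and R: "R \<in> x" and BR: "Max B < Max R" and y_eq: "y = insert (R \<union> B) (x - {R, B})"
    using xy by (auto simp: merges_def)
  note nB = nc_block[OF x B] and nR = nc_block[OF x R]
  have "B \<noteq> R" using BR by auto
  have disj: "B \<inter> R = {}" using nc_block_eq[OF x B R] \<open>B \<noteq> R\<close> by blast
  have Bb: "Min B \<le> u" "u \<le> Max B" if "u \<in> B" for u using nB that by auto
  \<comment> \<open>A vertex \<open>r\<close> of \<open>R\<close> strictly inside the range of
    \<open>B\<close> would give the crossing \<open>Min B < r < Max B < Max R\<close>.\<close>
  have gap: "r < Min B \<or> Max B < r" if r: "r \<in> R" for r
  proof (rule ccontr)
    assume "\<not> ?thesis"
    moreover have "r \<noteq> Min B" "r \<noteq> Max B" using r nB(4,6) disj by auto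
    ultimately have "Min B < r" "r < Max B" by linarith+
    then have "crossing B R" using crossingI[OF nB(6) r nB(4) nR(4) _ _ BR] by blast
    then show False using nc_not_crossing[OF x B R \<open>B \<noteq> R\<close>] by blast
  qed
  define e where "e = Min {w\<in>R. Max B < w}"
  have "{w\<in>R. Max B < w} \<noteq> {}" using nR(4) BR by blast
  then have "e \<in> {w\<in>R. Max B < w}" unfolding e_def using nR(1) by (intro Min_in) auto
  then have e: "e \<in> R" "Max B < e" by auto
  have e_le: "e \<le> w" if "w \<in> R" "Max B < w" for w
    unfolding e_def using that nR by (intro Min_le) auto
  have "Min B \<le> Max B" using nB by auto
  then have be: "Min B < e" using e by simp
  let ?t = "Transposition.transpose (Min B) e"
  have RBfin: "finite (R \<union> B)" using nB nR by auto
  have RBy: "R \<union> B \<in> y" using y_eq by simp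
  have t_fix: "?t w = w" if "w \<noteq> Min B" "w \<noteq> e" for w using that by (simp add: Transposition.transpose_def)
  have "NC_perm y v = ?t (NC_perm x v)" for v
  proof -
    consider "v \<notin> {1..m}" | C where "C \<in> x" "v \<in> C" "C \<noteq> R" "C \<noteq> B" | "v \<in> B" | "v \<in> R"
      using nc_block_exists[OF x] by metis
    then show ?thesis
    proof cases
      case 1
      then have "v \<noteq> Min B" "v \<noteq> e" using nB(3,6) nR(3) e by auto
      then show ?thesis using 1 NC_perm_outside[OF x] NC_perm_outside[OF y] t_fix by simp
    next
      case 2
      then have Cy: "C \<in> y" using y_eq by simp
      have "next_vertex C v \<in> C" using nc_block[OF x 2(1)] next_vertex_in by blast
      then have "next_vertex C v \<noteq> Min B" "next_vertex C v \<noteq> e"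
        using nc_block_eq[OF x 2(1) B] nc_block_eq[OF x 2(1) R] 2 nB e by metis+
      then show ?thesis using NC_perm_block[OF x 2(1,2)] NC_perm_block[OF y Cy 2(2)] t_fix by simp
    next
      case 3
      have p: "NC_perm x v = next_vertex B v" "NC_perm y v = next_vertex (R \<union> B) v"
        using NC_perm_block[OF x B 3] NC_perm_block[OF y RBy] 3 by auto
      show ?thesis
      proof (rule next_vertex_cases[OF nB(1,2), of v])
        assume w: "next_vertex B v \<in> B" "v < next_vertex B v" "\<And>u. u \<in> B \<Longrightarrow> v < u \<Longrightarrow> next_vertex B v \<le> u"
        have "next_vertex (R \<union> B) v = next_vertex B v"
        proof (rule next_vertexI1[OF RBfin])
          fix u assume "u \<in> R \<union> B" "v < u"
          then show "next_vertex B v \<le> u" using w gap[of u] Bb[OF w(1)] Bb[OF 3] by force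
        qed (use w in auto)
        moreover have "next_vertex B v \<noteq> Min B" "next_vertex B v \<noteq> e"
          using w Bb[OF 3] Bb[OF w(1)] e by auto
        ultimately show ?thesis using p t_fix by simp
      next
        assume w: "next_vertex B v = Min B" "\<And>u. u \<in> B \<Longrightarrow> u \<le> v"
        then have v: "v = Max B" using 3 nB by (metis Bb(2) le_antisym)
        have "next_vertex (R \<union> B) v = e"
        proof (rule next_vertexI1[OF RBfin])
          fix u assume "u \<in> R \<union> B" "v < u"
          then show "e \<le> u" using e_le[of u] v Bb(2)[of u] by auto
        qed (use e v in auto)
        then show ?thesis using p w by simp
      qed
    next
      case 4
      have p: "NC_perm x v = next_vertex R v" "NC_perm y v = next_vertex (R \<union> B) v"
        using NC_perm_block[OF x R 4] NC_perm_block[OF y RBy] 4 by auto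
      show ?thesis
      proof (rule next_vertex_cases[OF nR(1,2), of v])
        assume w: "next_vertex R v \<in> R" "v < next_vertex R v" "\<And>u. u \<in> R \<Longrightarrow> v < u \<Longrightarrow> next_vertex R v \<le> u"
        show ?thesis
        \<comment> \<open>In the first case \<open>B\<close> lies between \<open>v\<close> and its
          successor in \<open>R\<close>; that successor is \<open>e\<close>, and the new one is
          \<open>Min B\<close>.\<close>
        proof (cases "v < Min B \<and> Max B < next_vertex R v")
          case True
          have "next_vertex R v = e"
            using True w(3)[OF e(1)] e e_le[OF w(1)] be by auto
          moreover have "next_vertex (R \<union> B) v = Min B"
          proof (rule next_vertexI1[OF RBfin])
            fix u assume "u \<in> R \<union> B" "v < u"
            then show "Min B \<le> u" using True w(3)[of u] Bb(1)[of u] \<open>Min B \<le> Max B\<close> by force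
          qed (use nB True in auto)
          ultimately show ?thesis using p by simp
        next
          case False
          have "next_vertex (R \<union> B) v = next_vertex R v"
          proof (rule next_vertexI1[OF RBfin])
            fix u assume u: "u \<in> R \<union> B" "v < u"
            show "next_vertex R v \<le> u"
            proof (cases "u \<in> R")
              case False
              then have "u \<in> B" using u by simp
              then show ?thesis
                using u Bb[of u] gap[OF 4] gap[OF w(1)] \<open>\<not> (v < Min B \<and> Max B < next_vertex R v)\<close> by force
            qed (use w u in auto)
          qed (use w in auto)
          moreover have "next_vertex R v \<noteq> Min B" using w(1) nB(6) disj by (metis disjoint_iff)
          moreover have "next_vertex R v \<noteq> e"
            using False gap[OF 4] w e_le[OF 4] e by auto
          ultimately show ?thesis using p t_fix by simp
        qed
      next
        assume w: "next_vertex R v = Min R" "\<And>u. u \<in> R \<Longrightarrow> u \<le> v"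
        have v: "Max R \<le> v" using w nR by auto
        show ?thesis
        \<comment> \<open>Now \<open>v\<close> is \<open>Max R\<close> and its successor wraps
          around. If \<open>R\<close> starts first, nothing changes; otherwise all of
          \<open>B\<close> precedes \<open>R\<close>, so the old successor \<open>Min R\<close> is
          \<open>e\<close> and the new one is \<open>Min B\<close>.\<close>
        proof (cases "Min R < Min B")
          case True
          have "next_vertex (R \<union> B) v = Min R"
          proof (rule next_vertexI2[OF RBfin])
            fix u assume "u \<in> R \<union> B"
            then consider "u \<in> R" | "u \<in> B" by blast
            then show "u \<le> v" "Min R \<le> u" using v BR Bb[of u] True w(2)[of u] Min_le[OF nR(1), of u]
              by (cases; linarith)+
          qed (use nR in auto)
          then show ?thesis using p w True be t_fix by simp
        next
          case False
          then have "Max B < Min R" using gap[OF nR(6)] by simp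
          then have "Min R = e" using e_le[OF nR(6)] Min_le[OF nR(1) e(1)] by simp
          moreover have "next_vertex (R \<union> B) v = Min B"
          proof (rule next_vertexI2[OF RBfin])
            fix u assume "u \<in> R \<union> B"
            then consider "u \<in> R" | "u \<in> B" by blast
            then show "u \<le> v" "Min B \<le> u"
              using v BR Bb[of u] False Min_le[OF nR(1), of u] w(2)[of u] by (cases; linarith)+
          qed (use nB in auto)
          ultimately show ?thesis using p w by simp
        qed
      qed
    qed
  qed
  then have "NC_perm y = ?t \<circ> NC_perm x" by (simp add: fun_eq_iff)
  then have "NC_perm y \<circ> inv (NC_perm x) = ?t"
    using NC_perm_inv[OF x] by (simp add: comp_assoc)
  then show ?thesis using Min_transposition[OF be] by simp
qed

section \<open>Block maxima, merges and saturated chains\<close>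

definition maxs :: "nat set set \<Rightarrow> nat set" where
  "maxs \<pi> = Max ` \<pi>"

lemma maxs_subset: "x \<in> nc_partitions m \<Longrightarrow> maxs x \<subseteq> {1..m}"
  using nc_block(5) by (auto simp: maxs_def)

lemma maxs_antimono:
  assumes "x \<in> nc_partitions m" "y \<in> nc_partitions m" "refines {1..m} x y"
  shows "maxs y \<subseteq> maxs x"
proof
  fix v assume "v \<in> maxs y"
  then obtain Y where Y: "Y \<in> y" "v = Max Y" by (auto simp: maxs_def)
  note nY = nc_block[OF assms(2) Y(1)]
  obtain X where X: "X \<in> x" "v \<in> X" using nc_block_exists[OF assms(1)] nY(5) Y by metis
  have "X \<subseteq> Y" using refines_block_subset[OF assms(3) X(1) Y(1) X(2)] nY(4) Y by simp
  then have "Max X = v" using X Y nY(1) by (intro Max_eqI) (auto intro: finite_subset)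
  then show "v \<in> maxs x" using X by (auto simp: maxs_def)
qed

text \<open>Inside a block \<open>Y\<close> of \<open>y\<close> that is split in \<open>x\<close>,
  the two blocks of \<open>x\<close> reaching furthest to the right are merged. The last conclusion,
  locating the merged block inside a block of \<open>y\<close> with the same maximum, serves to
  transfer tameness.\<close>

lemma merge_exists:
  assumes x: "x \<in> nc_partitions m" and y: "y \<in> nc_partitions m" 
    and xy: "refines {1..m} x y" and ne: "x \<noteq> y"
  obtains B R z where "merges x B R z" "z \<in> nc_partitions m" "refines {1..m} x z" "refines {1..m} z y"
    "\<exists>Y\<in>y. Max Y = Max R \<and> R \<union> B \<subseteq> Y"
proof -
  have "\<not> y \<subseteq> x"
  proof
    assume "y \<subseteq> x"
    then have "refines {1..m} y x" using x y by (auto simp: refines_def nc_partitions_def)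
    then show False using refines_asym[OF xy] ne by blast
  qed
  then obtain Y where Y: "Y \<in> y" "Y \<notin> x" by blast
  note nY = nc_block[OF y Y(1)]
  obtain R where R: "R \<in> x" "Max Y \<in> R" using nc_block_exists[OF x nY(5)] .
  note nR = nc_block[OF x R(1)]
  have RY: "R \<subseteq> Y" using refines_block_subset[OF xy R(1) Y(1) R(2) nY(4)] .
  then have "Y - R \<noteq> {}" using R Y by auto
  \<comment> \<open>The rightmost vertex of \<open>Y\<close> outside the block \<open>R\<close> of
    \<open>Max Y\<close>. Every third block inside \<open>Y\<close> then lies to the left of both
    \<open>e\<close> and \<open>Max R\<close>.\<close>
  define e where "e = Max (Y - R)"
  have "e \<in> Y - R" unfolding e_def using \<open>Y - R \<noteq> {}\<close> nY by (intro Max_in) auto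
  then have e: "e \<in> Y" "e \<notin> R" by auto
  have e_ge: "u \<le> e" if "u \<in> Y" "u \<notin> R" for u
    unfolding e_def using that nY by (intro Max_ge) auto
  obtain B where B: "B \<in> x" "e \<in> B" using nc_block_exists[OF x, of e] e nY(3) by blast
  note nB = nc_block[OF x B(1)]
  have BY: "B \<subseteq> Y" using refines_block_subset[OF xy B(1) Y(1) B(2) e(1)] .
  have BR: "B \<noteq> R" using B e by auto
  then have disj: "B \<inter> R = {}" using nc_block_eq[OF x B(1) R(1)] by blast
  have MR: "Max R = Max Y" using RY R(2) nY(1) nR(1) by (intro Max_eqI) auto
  have "Max B \<noteq> Max R" using disj nB(4) nR(4) by auto
  moreover have "Max B \<le> Max Y" using BY nY nB by (intro Max_mono) auto
  ultimately have BRM: "Max B < Max R" using MR by simp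
  define z where "z = insert (R \<union> B) (x - {R, B})"
  have m: "merges x B R z" using B R BRM by (auto simp: merges_def z_def)
  have Un: "\<Union>z = \<Union>x" using B R by (auto simp: z_def)
  have part: "partition_on {1..m} z"
  proof (rule partition_onI)
    show "\<Union>z = {1..m}" using Un partition_onD1[OF nc_partitionsD(1)[OF x]] by simp
    show "{} \<notin> z" using partition_onD3[OF nc_partitionsD(1)[OF x]] nB by (auto simp: z_def)
    have "C \<inter> D = {}" if "C \<in> x" "D \<in> x" "C \<noteq> D" for C D
      using nc_block_eq[OF x that(1,2)] that(3) by blast
    then show "disjnt p q" if "p \<in> z" "q \<in> z" "p \<noteq> q" for p q
      using that B(1) R(1) by (auto simp: z_def disjnt_def)
  qed
  have other: "\<not> crossing E (R \<union> B) \<and> \<not> crossing (R \<union> B) E" if E: "E \<in> x" "E \<noteq> R" "E \<noteq> B" for E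
  proof (cases "E \<subseteq> Y")
    case False
    obtain Z where Z: "Z \<in> y" "E \<subseteq> Z" using refines_block[OF xy E(1)] .
    then have "Z \<noteq> Y" using False by auto
    then show ?thesis
      using nc_not_crossing[OF y Z(1) Y(1)] nc_not_crossing[OF y Y(1) Z(1)] Z(2) RY BY
        crossing_mono[of E "R \<union> B" Z Y] crossing_mono[of "R \<union> B" E Y Z] by blast
  next
    case True
    have "E \<inter> R = {}" "E \<inter> B = {}" using nc_block_eq[OF x E(1)] E B(1) R(1) by blast+
    then have lt: "f < e" if "f \<in> E" for f using e_ge[of f] that True B(2) by (metis IntI
          empty_iff le_neq_implies_less subsetD)
    \<comment> \<open>Both crossing patterns of \<open>E\<close> with \<open>R \<union> B\<close>
      contain a vertex \<open>u\<close> between two vertices of \<open>E\<close>. Since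
      \<open>R\<close> and \<open>B\<close> also have vertices to the right of \<open>E\<close>,
      this would already be a crossing of \<open>E\<close> with \<open>R\<close> or with
      \<open>B\<close>.\<close>
    have sep: "\<not> (f < u \<and> u < f')" if "f \<in> E" "f' \<in> E" "u \<in> R \<union> B" for f f' u
    proof
      assume fu: "f < u \<and> u < f'"
      have "e < Max R" using MR e nY R by (metis Max_ge le_neq_implies_less)
      then have "f' < Max R" using lt[OF that(2)] by simp
      then have "crossing E R \<or> crossing E B"
        using that fu nR(4) B(2) lt[OF that(2)] unfolding crossing_def by blast
      then show False using nc_not_crossing[OF x E(1)] R(1) B(1) E by metis
    qed
    then show ?thesis unfolding crossing_def by blast
  qed
  have "noncrossing z"
    using other nc_partitionsD(2)[OF x] unfolding noncrossing_def z_def by blast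
  then have znc: "z \<in> nc_partitions m" using part by (simp add: nc_partitions_def)
  have "\<exists>D\<in>z. C \<subseteq> D" if "C \<in> x" for C
    using that by (cases "C = R \<or> C = B") (auto simp: z_def)
  then have "refines {1..m} x z"
    using part nc_partitionsD(1)[OF x] unfolding refines_def by blast
  moreover have "refines {1..m} z y"
    unfolding refines_def
  proof (intro conjI ballI part nc_partitionsD(1)[OF y])
    fix C assume "C \<in> z"
    then have "C = R \<union> B \<or> C \<in> x" by (auto simp: z_def)
    then show "\<exists>D\<in>y. C \<subseteq> D" using RY BY Y(1) xy unfolding refines_def by blast
  qed
  moreover have "\<exists>Y\<in>y. Max Y = Max R \<and> R \<union> B \<subseteq> Y" using Y(1) MR RY BY by auto
  ultimately show ?thesis using that[OF m znc] by blast
qed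

lemma merge_maxs:
  assumes x: "x \<in> nc_partitions m" and xy: "merges x B R y"
  shows "maxs y = maxs x - {Max B}" "Max B \<in> maxs x" "Max B < m"
proof -
  have B: "B \<in> x" and R: "R \<in> x" and BR: "Max B < Max R" and y_eq: "y = insert (R \<union> B) (x - {R, B})"
    using xy by (auto simp: merges_def)
  note nB = nc_block[OF x B] and nR = nc_block[OF x R]
  show "Max B \<in> maxs x" using B by (auto simp: maxs_def)
  show "Max B < m" using nR(5) BR by auto
  have M: "Max (R \<union> B) = Max R" using nB nR BR by (simp add: Max_Un)
  have "C = B" if "C \<in> x" "Max C = Max B" for C
    using nc_block_eq[OF x that(1) B] nc_block[OF x that(1)] nB that(2) by metis
  then show "maxs y = maxs x - {Max B}"
    using B R BR M by (auto simp: maxs_def y_eq)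
qed

text \<open>The number of block maxima is the number of blocks and so serves as a decreasing rank:
  already the first merge towards \<open>y\<close> removes a maximum.\<close>

lemma maxs_strict:
  assumes x: "x \<in> nc_partitions m" and y: "y \<in> nc_partitions m" 
    and xy: "refines {1..m} x y" and ne: "x \<noteq> y"
  shows "maxs y \<subset> maxs x"
proof -
  obtain B R z where z: "merges x B R z" "z \<in> nc_partitions m" "refines {1..m} z y"
    using merge_exists[OF assms] by metis
  then show ?thesis
    using merge_maxs[OF x z(1)] maxs_antimono[OF z(2) y z(3)] by blast
qed

definition saturated :: "nat \<Rightarrow> nat set set list \<Rightarrow> bool" where
  "saturated m L \<longleftrightarrow> L \<noteq> [] \<and> hd L = NC_min m \<and> last L = NC_max m \<and> set L \<subseteq> nc_partitions m \<and>
     (\<forall>i. Suc i < length L \<longrightarrow>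
        refines {1..m} (L ! i) (L ! Suc i) \<and> (\<exists>B R. merges (L ! i) B R (L ! Suc i)))"

lemma saturated_refines:
  assumes L: "saturated m L" and ij: "i \<le> j" "j < length L"
  shows "refines {1..m} (L ! i) (L ! j)"
  using ij
proof (induction j rule: dec_induct)
  case base
  then have "L ! i \<in> nc_partitions m" using L by (auto simp: saturated_def)
  then show ?case using refines_refl nc_partitionsD by blast
next
  case (step j)
  then show ?case using L refines_trans unfolding saturated_def by (metis Suc_lessD)
qed

lemma maxs_NC_min: "maxs (NC_min m) = {1..m}"
  by (auto simp: maxs_def NC_min_def image_image)

lemma maxs_NC_max: "1 \<le> m \<Longrightarrow> maxs (NC_max m) = {m}"
proof -
  assume "1 \<le> m"
  then have "Max {1..m} = m" by (intro Max_eqI) auto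
  then show ?thesis by (simp add: maxs_def NC_max_def)
qed

text \<open>\<open>B i\<close> is the block absorbed at step \<open>i\<close>. Each step deletes one
  maximum, and the set of maxima shrinks from \<open>{1..m}\<close> to \<open>{m}\<close>; so each
  vertex below \<open>m\<close> is deleted exactly once, which gives the bijection and the
  length.\<close>

lemma saturated_steps:
  assumes L: "saturated m L" and m: "1 \<le> m"
  obtains B where
    "\<And>i. i < m - 1 \<Longrightarrow> B i \<in> L ! i"
    "\<And>j. j < m \<Longrightarrow> maxs (L ! j) = {1..m} - (\<lambda>i. Max (B i)) ` {..<j}"
    "bij_betw (\<lambda>i. Max (B i)) {..<m - 1} {1..<m}"
    "length L = m" "length (chain_label L) = m - 1"
    "\<And>i. i < m - 1 \<Longrightarrow> chain_label L ! i = Min (B i)"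
proof -
  have nc: "\<And>i. i < length L \<Longrightarrow> L ! i \<in> nc_partitions m" and "L \<noteq> []"
    using L by (auto simp: saturated_def)
  have "\<forall>i. \<exists>B. Suc i < length L \<longrightarrow> (\<exists>R. merges (L ! i) B R (L ! Suc i))"
    using L by (auto simp: saturated_def)
  then obtain B where B: "\<And>i. Suc i < length L \<Longrightarrow> \<exists>R. merges (L ! i) (B i) R (L ! Suc i)"
    by metis
  let ?v = "\<lambda>i. Max (B i)"
  have v: "?v i \<in> maxs (L ! i) \<and> maxs (L ! Suc i) = maxs (L ! i) - {?v i}" if "Suc i < length L" for i
    using B[OF that] merge_maxs nc[OF Suc_lessD[OF that]] by metis
  have max_eq: "maxs (L ! j) = {1..m} - ?v ` {..<j} \<and> inj_on ?v {..<j}" if "j < length L" for j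
    using that
  proof (induction j)
    case 0
    have "L ! 0 = NC_min m" using L hd_conv_nth[OF \<open>L \<noteq> []\<close>] by (simp add: saturated_def)
    then show ?case by (simp add: maxs_NC_min)
  next
    case (Suc j)
    then show ?case using v[OF Suc.prems] by (auto simp: lessThan_Suc)
  qed
  let ?n = "length L - 1"
  have n: "?n < length L" using \<open>L \<noteq> []\<close> by simp
  have "{1..m} - ?v ` {..<?n} = {m}"
    using max_eq[OF n] L maxs_NC_max[OF m] last_conv_nth[OF \<open>L \<noteq> []\<close>] by (simp add: saturated_def)
  moreover have "?v ` {..<?n} \<subseteq> {1..m}"
  proof
    fix u assume "u \<in> ?v ` {..<?n}"
    then obtain i where "u = ?v i" "Suc i < length L" by auto
    then show "u \<in> {1..m}" using v[of i] maxs_subset[OF nc[of i]] by auto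
  qed
  ultimately have "?v ` {..<?n} = {1..m} - {m}" by blast
  then have im: "?v ` {..<?n} = {1..<m}" by auto
  then have bij: "bij_betw ?v {..<?n} {1..<m}"
    using max_eq[OF n] by (simp add: bij_betw_def)
  then have nm: "?n = m - 1" using bij_betw_same_card by fastforce
  then have len: "length L = m" using m n by simp
  have lab: "chain_label L ! i = Min (B i)" if "i < m - 1" for i
  proof -
    have i: "Suc i < length L" using that len by simp
    \<comment> \<open>\<open>chain_label\<close> counts steps from 1, so its entry at index
      \<open>i\<close> compares \<open>L ! i\<close> with \<open>L ! Suc i\<close>.\<close>
    have "[1..<length L] ! i = Suc i" using i by simp
    then have "chain_label L ! i = smaller_moved (NC_perm (L ! Suc i) \<circ> inv (NC_perm (L ! i)))"
      using i unfolding chain_label_def by (subst nth_map) (simp_all add: One_nat_def)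
    then show ?thesis using B[OF i] merge_label nc[OF i] nc[OF Suc_lessD[OF i]] by metis
  qed
  show ?thesis
  proof (rule that)
    show "B i \<in> L ! i" if "i < m - 1" for i
      using B[of i] that len by (auto simp: merges_def)
    show "length (chain_label L) = m - 1" using len by (simp add: chain_label_def)
  qed (use max_eq len bij nm lab in auto)
qed

text \<open>If the sorted entry at index \<open>j\<close> exceeded \<open>j + 1\<close>, at most
  \<open>j\<close> entries would be at most \<open>j + 1\<close>. But the \<open>j + 1\<close>
  positions at which \<open>v\<close> takes the values from 1 to \<open>j + 1\<close> carry such
  entries.\<close>

lemma parking_functionI:
  assumes len: "length as = n" and v: "bij_betw v {..<n} {1..n}"
    and le: "\<And>i. i < n \<Longrightarrow> 0 < as ! i \<and> as ! i \<le> v i"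
  shows "parking_function n as"
proof -
  have "sort as ! j \<le> j + 1" if j: "j < n" for j
  proof (rule ccontr)
    assume big: "\<not> ?thesis"
    let ?p = "\<lambda>a. a \<le> j + 1"
    have "i < j" if "i < length (sort as)" "?p (sort as ! i)" for i
    proof (rule ccontr)
      assume "\<not> i < j"
      then have "sort as ! j \<le> sort as ! i" using that(1) by (intro sorted_nth_mono) auto
      then show False using that big by simp
    qed
    then have "card {i. i < length (sort as) \<and> ?p (sort as ! i)} \<le> card {..<j}"
      by (intro card_mono) auto
    then have "length (filter ?p (sort as)) \<le> j"
      by (simp add: length_filter_conv_card)
    moreover have "length (filter ?p (sort as)) = length (filter ?p as)"
      by (metis filter_sort length_sort)
    moreover have "j + 1 \<le> length (filter ?p as)"
    proof -
      have "v ` {i\<in>{..<n}. v i \<le> j + 1} = {1..j+1}"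
      proof (intro equalityI subsetI)
        fix u assume u: "u \<in> {1..j+1}"
        then have "u \<in> {1..n}" using j by auto
        then obtain i where "i < n" "v i = u"
          using v unfolding bij_betw_def by (metis imageE lessThan_iff)
        then show "u \<in> v ` {i\<in>{..<n}. v i \<le> j + 1}" using u by auto
      qed (use v in \<open>auto simp: bij_betw_def\<close>)
      then have "j + 1 = card (v ` {i\<in>{..<n}. v i \<le> j + 1})" by simp
      also have "\<dots> \<le> card {i\<in>{..<n}. v i \<le> j + 1}" by (intro card_image_le) simp
      also have "\<dots> \<le> card {i. i < length as \<and> as ! i \<le> j + 1}"
        using le len by (intro card_mono) (auto intro: order_trans)
      finally show ?thesis by (simp add: length_filter_conv_card)
    qed
    ultimately show False by simp
  qed
  moreover have "0 < a" if "a \<in> set as" for a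
    using that le len by (auto simp: in_set_conv_nth)
  ultimately show ?thesis using len by (simp add: parking_function_def)
qed

context parking_space
begin

text \<open>The label at step \<open>i\<close> is \<open>Min (B i)\<close> and the deleted maximum
  is \<open>Max (B i)\<close>. The condition on the labels determines when the absorbed blocks are
  singletons, and the absorbed block contains all earlier blocks with the same maximum.\<close>

lemma label_PF_iff:
  assumes L: "saturated m L"
  shows "chain_label L \<in> PF (m - 1) k \<longleftrightarrow> set L \<subseteq> tame \<and> set L \<inter> mid \<noteq> {}"
proof -
  have "1 \<le> m" using k by simp
  obtain B where B: "\<And>i. i < m - 1 \<Longrightarrow> B i \<in> L ! i"
    and maxs_L: "\<And>j. j < m \<Longrightarrow> maxs (L ! j) = {1..m} - (\<lambda>i. Max (B i)) ` {..<j}"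
    and bij: "bij_betw (\<lambda>i. Max (B i)) {..<m - 1} {1..<m}"
    and len: "length L = m" "length (chain_label L) = m - 1"
    and lab: "\<And>i. i < m - 1 \<Longrightarrow> chain_label L ! i = Min (B i)"
    using saturated_steps[OF L \<open>1 \<le> m\<close>] by blast
  have nc: "\<And>i. i < m \<Longrightarrow> L ! i \<in> nc_partitions m" using L len by (auto simp: saturated_def)
  have nB: "finite (B i)" "B i \<noteq> {}" "B i \<subseteq> {1..m}" "Max (B i) \<in> B i" "Min (B i) \<in> B i" 
    if "i < m - 1" for i
    using nc_block[OF nc B[OF that]] that by auto
  have Mm: "Min (B i) \<le> Max (B i)" if "i < m - 1" for i using nB[OF that] by simp
  have single: "B i = {u}" if "i < m - 1" "Min (B i) = u" "Max (B i) = u" for i u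
  proof -
    have "w = u" if "w \<in> B i" for w
      using Min_le[OF nB(1) that] Max_ge[OF nB(1) that] \<open>i < m - 1\<close> \<open>Min (B i) = u\<close> \<open>Max (B i) = u\<close> by simp
    then show ?thesis using nB(2)[OF that(1)] by blast
  qed
  have labels: "set (chain_label L) = (\<lambda>i. Min (B i)) ` {..<m - 1}"
    using len(2) lab by (auto simp: set_conv_nth image_iff) metis
  have absorbed: "\<exists>i<m - 1. Max (B i) = u" if "u \<in> {1..<m}" for u
    using bij that unfolding bij_betw_def by (metis imageE lessThan_iff)
  \<comment> \<open>A block keeping its maximum can only grow until it is absorbed, so the absorbed
    block controls all stages before.\<close>
  have later: "C \<subseteq> B i" if "i < m - 1" "Max (B i) = Max C" "j < m" "C \<in> L ! j" for i j C
  proof -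
    have "Max C \<in> maxs (L ! j)" using that by (auto simp: maxs_def)
    then have "j \<le> i" using maxs_L[OF that(3)] that(2) by (metis DiffD2 image_eqI lessThan_iff not_less)
    then have "refines {1..m} (L ! j) (L ! i)" using saturated_refines[OF L] that len by simp
    then show ?thesis
      using refines_block_subset[of _ "L ! j" "L ! i" C "B i" "Max C"] that B[OF that(1)]
        nB(4)[OF that(1)] nc_block(4)[OF nc[OF that(3)] that(4)] by metis
  qed
  have pf: "parking_function (m - 1) (chain_label L)"
  proof (rule parking_functionI[OF len(2), of "\<lambda>i. Max (B i)"])
    have "{1..<m} = {1..m - 1}" using k by auto
    then show "bij_betw (\<lambda>i. Max (B i)) {..<m - 1} {1..m - 1}" using bij by simp
    show "0 < chain_label L ! i \<and> chain_label L ! i \<le> Max (B i)" if "i < m - 1" for i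
      using lab[OF that] Mm[OF that] nB(3,5)[OF that] by auto
  qed
  have PF_iff: "chain_label L \<in> PF (m - 1) k \<longleftrightarrow>
      k \<notin> set (chain_label L) \<and> {k<..<m} \<subseteq> set (chain_label L)"
  proof -
    have "k \<in> {1..m - 1}" using k by auto
    moreover have "(\<forall>j\<in>undesired (m - 1) (chain_label L). j \<le> k) \<longleftrightarrow> {k<..<m} \<subseteq> set (chain_label L)"
    proof
      assume small: "\<forall>j\<in>undesired (m - 1) (chain_label L). j \<le> k"
      show "{k<..<m} \<subseteq> set (chain_label L)"
      proof
        fix j assume "j \<in> {k<..<m}"
        then have "j \<in> {1..m - 1}" "\<not> j \<le> k" by auto
        then show "j \<in> set (chain_label L)" using small unfolding undesired_def by blast
      qed
    next
      assume sub: "{k<..<m} \<subseteq> set (chain_label L)"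
      show "\<forall>j\<in>undesired (m - 1) (chain_label L). j \<le> k"
      proof
        fix j assume "j \<in> undesired (m - 1) (chain_label L)"
        then have "j \<le> m - 1" "j \<notin> {k<..<m}" using sub by (auto simp: undesired_def)
        then show "j \<le> k" using k by auto
      qed
    qed
    ultimately show ?thesis using pf by (simp add: PF_def undesired_def)
  qed
  show ?thesis
  proof
    assume "chain_label L \<in> PF (m - 1) k"
    then have kl: "k \<notin> set (chain_label L)" and gt: "{k<..<m} \<subseteq> set (chain_label L)"
      using PF_iff by auto
    \<comment> \<open>Downward induction on \<open>u\<close>. The label \<open>u\<close> occurs as
      \<open>Min (B i')\<close> for some \<open>i'\<close>; if \<open>Max (B i')\<close> were
      larger, \<open>B i'\<close> would be a singleton by induction, with minimum larger than
      \<open>u\<close>. So both extremes are \<open>u\<close>.\<close>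
    have eq: "B i = {u}" if "k < u" "u < m" "i < m - 1" "Max (B i) = u" for u i
      using that
    proof (induction "m - u" arbitrary: u i rule: less_induct)
      case less
      have "u \<in> set (chain_label L)" using gt less.prems by auto
      then obtain i' where i': "i' < m - 1" "Min (B i') = u" using labels by auto
      have "Max (B i') = u"
      proof (rule ccontr)
        assume "Max (B i') \<noteq> u"
        then have "u < Max (B i')" using Mm[OF i'(1)] i' by simp
        moreover have "Max (B i') < m" using bij i'(1) by (auto simp: bij_betw_def)
        ultimately have "B i' = {Max (B i')}"
          using less.prems i' by (intro less.hyps) auto
        then have "Min (B i') = Max (B i')" by (metis Min_singleton)
        then show False using i' \<open>u < Max (B i')\<close> by simp
      qed
      then have "i = i'" using bij less.prems i' unfolding bij_betw_def inj_on_def by auto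
      then show ?case using single i' \<open>Max (B i') = u\<close> by blast
    qed
    have "L ! j \<in> tame" if j: "j < m" for j
    proof -
      have "C = {Max C}" if C: "C \<in> L ! j" "k < Max C" "Max C < m" for C
      proof -
        obtain i where i: "i < m - 1" "Max (B i) = Max C" using absorbed[of "Max C"] C by auto
        then have "C \<subseteq> {Max C}" using later[OF i j C(1)] eq[OF C(2,3) i] by simp
        then show ?thesis using nc_block(2)[OF nc[OF j] C(1)] by blast
      qed
      then show ?thesis using nc[OF j] by (simp add: tame_def)
    qed
    then have t: "set L \<subseteq> tame" using len by (auto simp: in_set_conv_nth)
    obtain i where i: "i < m - 1" "Max (B i) = k" using absorbed[of k] k by auto
    have "B i \<noteq> {k}" using kl labels i by (metis Min_singleton image_eqI lessThan_iff)
    then have "L ! i \<in> mid" using i B[OF i(1)] t len by (auto simp: mid_def)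
    moreover have "L ! i \<in> set L" using i(1) len(1) by (intro nth_mem) simp
    ultimately show "set L \<subseteq> tame \<and> set L \<inter> mid \<noteq> {}" using t by blast
  next
    assume asm: "set L \<subseteq> tame \<and> set L \<inter> mid \<noteq> {}"
    have t: "L ! j \<in> tame" if "j < m" for j using asm nth_mem[of j L] len(1) that by blast
    have eq: "B i = {Max (B i)}" if "i < m - 1" "k < Max (B i)" for i
    proof -
      have "Max (B i) < m" using bij that(1) by (auto simp: bij_betw_def)
      then show ?thesis using t[of i] B[OF that(1)] that by (auto simp: tame_def)
    qed
    have "{k<..<m} \<subseteq> set (chain_label L)"
    proof
      fix u assume u: "u \<in> {k<..<m}"
      then obtain i where i: "i < m - 1" "Max (B i) = u" using absorbed[of u] by auto
      then have "Min (B i) = u" using eq[OF i(1)] u by (metis Min_singleton greaterThanLessThan_iff)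
      then show "u \<in> set (chain_label L)" using labels i by auto
    qed
    moreover have "k \<notin> set (chain_label L)"
    proof
      \<comment> \<open>A block absorbed with label \<open>k\<close> has maximum \<open>k\<close>,
        as larger maxima belong to singletons. So it is \<open>{k}\<close>, and no stage has a
        bigger block with maximum \<open>k\<close>, against \<open>mid\<close>.\<close>
      assume "k \<in> set (chain_label L)"
      then obtain i where i: "i < m - 1" "Min (B i) = k" using labels by auto
      have "Max (B i) = k"
      proof (rule ccontr)
        assume "Max (B i) \<noteq> k"
        then have "k < Max (B i)" using Mm[OF i(1)] i by simp
        then show False using eq[OF i(1)] i(2) by (metis Min_singleton less_irrefl)
      qed
      then have Bk: "B i = {k}" using single i by blast
      obtain z where "z \<in> set L" and z: "z \<in> mid" using asm by blast
      then obtain j where j: "z = L ! j" "j < m" using len by (auto simp: in_set_conv_nth)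
      obtain C where C: "C \<in> z" "Max C = k" "C \<noteq> {k}" using z by (auto simp: mid_def)
      have "C \<subseteq> {k}" using later[OF i(1) _ j(2)] C j Bk \<open>Max (B i) = k\<close> by metis
      then show False using C nc_block(2)[OF nc[OF j(2)]] j by blast
    qed
    ultimately show "chain_label L \<in> PF (m - 1) k" using PF_iff by blast
  qed
qed

end

section \<open>Maximal simplices of the link\<close>

lemma sorted_wrt_unique:
  assumes "\<And>x y. R x y \<Longrightarrow> \<not> R y x"
    and "sorted_wrt R xs" "sorted_wrt R ys" "set xs = set ys"
  shows "xs = ys"
  using assms(2-)
proof (induction xs arbitrary: ys)
  case (Cons x xs)
  then obtain y zs where ys: "ys = y # zs" by (cases ys) auto
  have irr: "\<not> R a a" for a using assms(1) by blast
  have "x = y"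
  proof (rule ccontr)
    assume "x \<noteq> y"
    then have "R x y" "R y x" using Cons.prems ys by auto
    then show False using assms(1) by blast
  qed
  moreover have "set xs = set zs"
  proof -
    have "x \<notin> set xs" "y \<notin> set zs" using Cons.prems ys irr by auto
    then show ?thesis using Cons.prems(3) ys \<open>x = y\<close> by auto
  qed
  ultimately show ?case using Cons ys by auto
qed simp

text \<open>The rank \<open>f\<close> decreases along \<open>R\<close>, so an element of largest
  rank comes first. Together with uniqueness this evaluates the description in
  \<open>increasing_list\<close>; the rank used is the number of block maxima.\<close>

lemma sorted_wrt_exists:
  fixes f :: "'a \<Rightarrow> nat"
  assumes "finite C" "\<And>x y. x \<in> C \<Longrightarrow> y \<in> C \<Longrightarrow> x \<noteq> y \<Longrightarrow> R x y \<or> R y x"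
    "\<And>x y. x \<in> C \<Longrightarrow> y \<in> C \<Longrightarrow> R x y \<Longrightarrow> f y < f x"
  obtains xs where "set xs = C" "sorted_wrt R xs"
proof -
  have "\<exists>xs. set xs = C \<and> sorted_wrt R xs"
    using assms
  proof (induction "card C" arbitrary: C)
    case 0
    then show ?case by (intro exI[of _ "[]"]) simp
  next
    case (Suc c)
    have "Max (f ` C) \<in> f ` C" using Suc.hyps(2) Suc.prems(1) by (intro Max_in) auto
    then obtain x where x: "x \<in> C" "f x = Max (f ` C)" by auto
    have first: "R x y" if "y \<in> C - {x}" for y
    proof -
      have "f y \<le> f x" using that x Suc.prems(1) by auto
      then show ?thesis using Suc.prems(2)[of x y] Suc.prems(3)[of y x] that x by auto
    qed
    have "\<exists>xs. set xs = C - {x} \<and> sorted_wrt R xs"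
      using Suc.hyps(2) Suc.prems x by (intro Suc.hyps(1)) auto
    then obtain xs where "set xs = C - {x}" "sorted_wrt R xs" by blast
    then show ?case using first x by (intro exI[of _ "x # xs"]) auto
  qed
  then show ?thesis using that by blast
qed

lemma finite_chain_extremum:
  assumes "finite S" "S \<noteq> {}" "\<And>x y. x \<in> S \<Longrightarrow> y \<in> S \<Longrightarrow> R x y \<or> R y x"
    "\<And>x y z. x \<in> S \<Longrightarrow> y \<in> S \<Longrightarrow> z \<in> S \<Longrightarrow> R x y \<Longrightarrow> R y z \<Longrightarrow> R x z"
  shows "\<exists>x\<in>S. \<forall>y\<in>S. R x y"
  using assms
proof (induction S rule: finite_ne_induct)
  case (insert a S)
  have "\<exists>x\<in>S. \<forall>y\<in>S. R x y"
    by (rule insert.IH) (use insert.prems in blast)+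
  then obtain x where x: "x \<in> S" "\<forall>y\<in>S. R x y" by blast
  consider "R a x" | "R x a" using insert.prems(1)[of a x] x by blast
  then show ?case
  proof cases
    case 1
    then have "R a y" if "y \<in> S" for y using insert.prems(2)[of a x y] x that by blast
    then show ?thesis using insert.prems(1)[of a a] by blast
  qed (use x in blast)
next
  case (singleton a)
  then show ?case by blast
qed

lemma refines_chain_least:
  assumes "finite S" "S \<noteq> {}" "\<And>x y. x \<in> S \<Longrightarrow> y \<in> S \<Longrightarrow> refines A x y \<or> refines A y x"
  shows "\<exists>x\<in>S. \<forall>y\<in>S. refines A x y"
  by (rule finite_chain_extremum[OF assms]) (auto intro: refines_trans)

lemma refines_chain_greatest:
  assumes "finite S" "S \<noteq> {}" "\<And>x y. x \<in> S \<Longrightarrow> y \<in> S \<Longrightarrow> refines A x y \<or> refines A y x"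
  shows "\<exists>x\<in>S. \<forall>y\<in>S. refines A y x"
  using assms by (intro finite_chain_extremum[where R="\<lambda>x y. refines A y x"]) (auto intro: refines_trans)

lemma NC_min_nc: "NC_min m \<in> nc_partitions m"
  unfolding nc_partitions_def NC_min_def noncrossing_def
  by (auto simp: partition_on_singletons crossing_def)

lemma NC_max_nc: "1 \<le> m \<Longrightarrow> NC_max m \<in> nc_partitions m"
  unfolding nc_partitions_def NC_max_def noncrossing_def
  by (auto intro: partition_on_space)

lemma NC_min_refines:
  assumes "\<pi> \<in> nc_partitions m"
  shows "refines {1..m} (NC_min m) \<pi>"
  unfolding refines_def
proof (intro conjI ballI nc_partitionsD(1) NC_min_nc assms)
  fix X assume "X \<in> NC_min m"
  then obtain v where v: "X = {v}" "v \<in> {1..m}" by (auto simp: NC_min_def)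
  obtain B where "B \<in> \<pi>" "v \<in> B" using nc_block_exists[OF assms v(2)] .
  then show "\<exists>Y\<in>\<pi>. X \<subseteq> Y" using v by auto
qed

lemma refines_NC_max:
  assumes "1 \<le> m" "\<pi> \<in> nc_partitions m"
  shows "refines {1..m} \<pi> (NC_max m)"
  unfolding refines_def
proof (intro conjI ballI nc_partitionsD(1) NC_max_nc assms)
  show "\<exists>Y\<in>NC_max m. X \<subseteq> Y" if "X \<in> \<pi>" for X
    using nc_block(3)[OF assms(2) that] by (simp add: NC_max_def)
qed

text \<open>If some step of the chain were not a single merge, \<open>merge_exists\<close> would
  interpolate a partition strictly between, and adding it would enlarge the simplex.\<close>

lemma maximal_simplex_saturated:
  assumes m: "1 < m"
    and \<sigma>: "\<sigma> \<in> maximal_simplices (order_complex (nc_partitions m - {NC_min m, NC_max m}) (refines {1..m}))"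
  shows "saturated m (increasing_list m (\<sigma> \<union> {NC_min m, NC_max m})) \<and>
    set (increasing_list m (\<sigma> \<union> {NC_min m, NC_max m})) = \<sigma> \<union> {NC_min m, NC_max m}"
proof -
  let ?C = "\<sigma> \<union> {NC_min m, NC_max m}" and ?r = "refines {1..m}"
  let ?R = "\<lambda>x y. ?r x y \<and> x \<noteq> y"
  have m1: "1 \<le> m" using m by simp
  note min = NC_min_nc[of m] NC_min_refines[of _ m] and max = NC_max_nc[OF m1] refines_NC_max[OF m1]
  have \<sigma>': "finite \<sigma>" "\<sigma> \<subseteq> nc_partitions m - {NC_min m, NC_max m}" "\<And>x y. x \<in> \<sigma> \<Longrightarrow> y \<in> \<sigma> \<Longrightarrow> ?r x y \<or> ?r y x"
    using \<sigma> by (auto simp: maximal_simplices_def order_complex_def)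
  have C: "finite ?C" "?C \<subseteq> nc_partitions m" using \<sigma>' min max by auto
  have Ccomp: "?r x y \<or> ?r y x" if "x \<in> ?C" "y \<in> ?C" for x y
  proof -
    have "x \<in> nc_partitions m" "y \<in> nc_partitions m" using that C by blast+
    then show ?thesis using that \<sigma>'(3) min(2) max(2) by blast
  qed
  have dec: "card (maxs y) < card (maxs x)" if "x \<in> ?C" "y \<in> ?C" "?R x y" for x y
  proof -
    have "x \<in> nc_partitions m" "y \<in> nc_partitions m" using that C by blast+
    then have "maxs y \<subset> maxs x" "finite (maxs x)"
      using maxs_strict[of x m y] that(3) finite_subset[OF maxs_subset[of x m]] by simp_all
    then show ?thesis by (rule psubset_card_mono[rotated])
  qed
  obtain L where L: "set L = ?C" "sorted_wrt ?R L"
  proof (rule sorted_wrt_exists[of ?C ?R "\<lambda>x. card (maxs x)"])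
    show "?R x y \<or> ?R y x" if "x \<in> ?C" "y \<in> ?C" "x \<noteq> y" for x y
      using Ccomp[OF that(1,2)] that(3) by blast
  qed (use C(1) dec in blast)+
  have "increasing_list m ?C = L"
    unfolding increasing_list_def
  proof (rule the_equality)
    show "set L = ?C \<and> sorted_wrt ?R L" using L by simp
    show "L' = L" if "set L' = ?C \<and> sorted_wrt ?R L'" for L'
      using that L by (intro sorted_wrt_unique[of ?R]) (auto dest: refines_asym)
  qed
  moreover have "saturated m L"
    unfolding saturated_def
  proof (intro conjI allI impI)
    show "L \<noteq> []" using L by auto
    then have n: "0 < length L" by simp
    have nth: "L ! i \<in> ?C" if "i < length L" for i using L that nth_mem by blast
    have less: "?R (L ! i) (L ! j)" if "i < j" "j < length L" for i j
      using L(2) that by (simp add: sorted_wrt_iff_nth_less)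
    show "hd L = NC_min m"
    proof -
      obtain i where i: "i < length L" "L ! i = NC_min m" using L by (metis UnCI in_set_conv_nth insertI1)
      have "?r (NC_min m) (L ! 0)" using min(2) nth[OF n] C by blast
      then have "i = 0" using less[of 0 i] i refines_asym by (metis gr0I)
      then show ?thesis using i \<open>L \<noteq> []\<close> by (simp add: hd_conv_nth)
    qed
    show "last L = NC_max m"
    proof -
      obtain i where i: "i < length L" "L ! i = NC_max m" using L by (metis UnCI in_set_conv_nth insertI1 insertI2)
      have l: "length L - 1 < length L" using n by simp
      have "?r (L ! (length L - 1)) (NC_max m)" using max(2) nth[OF l] C by blast
      then have "\<not> i < length L - 1" using less[of i "length L - 1"] i l refines_asym by metis
      then have "i = length L - 1" using i by simp
      then show ?thesis using i \<open>L \<noteq> []\<close> by (simp add: last_conv_nth)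
    qed
    show "set L \<subseteq> nc_partitions m" using L C by simp
    fix i assume i: "Suc i < length L"
    let ?x = "L ! i" and ?y = "L ! Suc i"
    show xy: "?r ?x ?y" using less[OF lessI i] by blast
    have ne: "?x \<noteq> ?y" using less[OF lessI i] by blast
    have nc: "?x \<in> nc_partitions m" "?y \<in> nc_partitions m" using nth[of i] nth[OF i] i C by auto
    obtain B R z where z: "merges ?x B R z" "z \<in> nc_partitions m" "?r ?x z" "?r z ?y"
      using merge_exists[OF nc xy ne] by metis
    have xz: "?x \<noteq> z" using merge_maxs[OF nc(1) z(1)] by blast
    have "z = ?y"
    proof (rule ccontr)
      assume "z \<noteq> ?y"
      \<comment> \<open>Every member of the chain lies at or below \<open>?x\<close> or at or above
        \<open>?y\<close>, so it is comparable with \<open>z\<close>.\<close>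
      have side: "(?r c ?x \<and> ?r c z) \<or> (?r ?y c \<and> ?r z c)" if "c \<in> ?C" for c
      proof -
        have "c \<in> set L" using that L(1) by simp
        then obtain j where j: "j < length L" "c = L ! j" by (auto simp: in_set_conv_nth)
        have "c \<in> nc_partitions m" using that C(2) by blast
        then have rr: "?r c c" using nc_partitionsD(1) refines_refl by blast
        show ?thesis
        proof (cases "j \<le> i")
          case True
          then have "?r c ?x" using less[of j i] j i rr by (cases "j = i") auto
          then show ?thesis using refines_trans z(3) by blast
        next
          case False
          then have "?r ?y c" using less[of "Suc i" j] j i rr by (cases "j = Suc i") auto
          then show ?thesis using refines_trans z(4) by blast
        qed
      qed
      have "z \<notin> ?C"
        using side[of z] xz \<open>z \<noteq> ?y\<close> z refines_asym by blast
      moreover have "insert z \<sigma> \<in> order_complex (nc_partitions m - {NC_min m, NC_max m}) ?r"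
        using \<sigma>' side \<open>z \<notin> ?C\<close> z(2) nc_partitionsD(1)[OF z(2)] refines_refl
        unfolding order_complex_def by auto
      ultimately show False using \<sigma> by (auto simp: maximal_simplices_def)
    qed
    then show "\<exists>B R. merges ?x B R ?y" using z(1) by blast
  qed
  ultimately show ?thesis using L(1) by simp
qed

section \<open>The subcomplex as the order complex of \<open>le\<close>\<close>

context parking_space
begin

lemma NC_min_tame: "NC_min m \<in> tame"
  using NC_min_nc by (auto simp: tame_def NC_min_def)

lemma NC_max_tame: "NC_max m \<in> tame"
proof -
  have "Max {1..m} = m" using k by (intro Max_eqI) auto
  then show ?thesis using NC_max_nc[of m] k by (auto simp: tame_def NC_max_def)
qed

text \<open>The only new block has maximum \<open>Max Y\<close>. Were this strictly between
  \<open>k\<close> and \<open>m\<close>, tameness of \<open>y\<close> would make \<open>Y\<close> a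
  singleton, but \<open>Y\<close> also contains \<open>Max B\<close>.\<close>

lemma merge_tame:
  assumes x: "x \<in> tame" and y: "y \<in> tame" and z: "merges x B R z" "z \<in> nc_partitions m"
    and Y: "Y \<in> y" "Max Y = Max R" "R \<union> B \<subseteq> Y"
  shows "z \<in> tame"
proof -
  have BR: "B \<in> x" "R \<in> x" "Max B < Max R" and z_eq: "z = insert (R \<union> B) (x - {R, B})"
    using z by (auto simp: merges_def)
  note nB = nc_block[OF tame_nc[OF x] BR(1)] and nR = nc_block[OF tame_nc[OF x] BR(2)]
  have MY: "Max R \<le> k \<or> m \<le> Max R"
  proof (rule ccontr)
    assume "\<not> ?thesis"
    then have "Y = {Max Y}" using y Y by (auto simp: tame_def)
    then have "Max B = Max Y" using nB(4) Y(3) by blast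
    then show False using BR Y by simp
  qed
  have "Max (R \<union> B) = Max R" using nB nR BR by (simp add: Max_Un)
  then show ?thesis using x z(2) MY by (auto simp: tame_def z_eq)
qed

text \<open>The harder inclusion extends a chain for \<open>le\<close> by a member of
  \<open>mid\<close> comparable with all its elements, and then to a maximal chain of tame
  partitions. The point is that such a chain is maximal among all noncrossing partitions.\<close>

lemma with_faces_eq:
  assumes link: "link = order_complex (nc_partitions m - {NC_min m, NC_max m}) (refines {1..m})"
  shows "with_faces {\<sigma> \<in> maximal_simplices link. simplex_label m \<sigma> \<in> PF (m - 1) k}
    = order_complex (upper_part \<union> lower_part) le" (is "?K = ?O")
proof -
  let ?r = "refines {1..m}"
  have m1: "1 \<le> m" "1 < m" using k by auto
  have label: "simplex_label m \<sigma> \<in> PF (m - 1) k \<longleftrightarrow> \<sigma> \<subseteq> tame \<and> \<sigma> \<inter> mid \<noteq> {}"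
    if "\<sigma> \<in> maximal_simplices link" for \<sigma>
  proof -
    have "NC_min m \<notin> mid" "NC_max m \<notin> mid" using mid_proper by (auto simp: proper_def)
    then show ?thesis
      using maximal_simplex_saturated[OF m1(2) that[unfolded link]] label_PF_iff NC_min_tame NC_max_tame
      unfolding simplex_label_def by auto
  qed
  have rr: "?r x x" if "x \<in> tame" for x using that tame_partition refines_refl by blast
  show ?thesis
  proof (intro equalityI subsetI)
    fix \<tau> assume "\<tau> \<in> ?K"
    then obtain \<sigma> where \<sigma>: "\<sigma> \<in> maximal_simplices link" "simplex_label m \<sigma> \<in> PF (m - 1) k"
      and \<tau>: "\<tau> \<noteq> {}" "\<tau> \<subseteq> \<sigma>" by (auto simp: with_faces_def)
    have fin: "finite \<sigma>" and pr: "\<sigma> \<subseteq> nc_partitions m - {NC_min m, NC_max m}" 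
      and comp: "\<And>x y. x \<in> \<sigma> \<Longrightarrow> y \<in> \<sigma> \<Longrightarrow> ?r x y \<or> ?r y x"
      using \<sigma>(1) by (auto simp: maximal_simplices_def order_complex_def link)
    obtain z where tame\<sigma>: "\<sigma> \<subseteq> tame" and z: "z \<in> \<sigma>" "z \<in> mid" using label[OF \<sigma>(1)] \<sigma>(2) by blast
    have "x \<in> upper_part \<union> lower_part" if x: "x \<in> \<sigma>" for x
    proof -
      have xt: "x \<in> tame" and xp: "x \<in> proper" using x tame\<sigma> pr by (auto simp: proper_def)
      show ?thesis
      proof (cases "?r z x")
        case True
        then show ?thesis using xp z by (auto simp: upper_part_def)
      next
        case False
        then have xz: "?r x z" using comp x z by blast
        show ?thesis using xt
        proof (cases rule: tame_cases)
          case 1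
          then show ?thesis using xz z xp by (auto simp: lower_part_def)
        next
          case 2
          then show ?thesis using mid_upper_part by blast
        next
          case 3
          then show ?thesis using refines_high[OF xz] mid_not_high z by blast
        qed
      qed
    qed
    moreover have "le x y" if "x \<in> \<sigma>" "y \<in> \<sigma>" "?r x y" for x y
    proof -
      \<comment> \<open>Refinements of \<open>low\<close> partitions are \<open>low\<close> and
        coarsenings of \<open>high\<close> ones are \<open>high\<close>. The element
        \<open>z\<close> of \<open>mid\<close> is neither, so it can only lie between
        \<open>x\<close> and \<open>y\<close>.\<close>
      have "?r x z \<and> ?r z y" if "low x" "high y"
        using refines_low[of z x] refines_high[of y z] that mid_not_low[OF z(2)] mid_not_high[OF z(2)]
          comp[OF z(1) \<open>x \<in> \<sigma>\<close>] comp[OF z(1) \<open>y \<in> \<sigma>\<close>] z(1) pr by blast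
      then show ?thesis using that(3) z by (auto simp: le_def)
    qed
    then have "le x y \<or> le y x" if "x \<in> \<sigma>" "y \<in> \<sigma>" for x y using comp that by blast
    ultimately show "\<tau> \<in> ?O"
      using \<tau> fin unfolding order_complex_def by (auto intro: finite_subset)
  next
    fix \<tau> assume "\<tau> \<in> ?O"
    then have fin: "finite \<tau>" and ne: "\<tau> \<noteq> {}" and sub: "\<tau> \<subseteq> upper_part \<union> lower_part"
      and lecomp: "\<And>x y. x \<in> \<tau> \<Longrightarrow> y \<in> \<tau> \<Longrightarrow> le x y \<or> le y x" by (auto simp: order_complex_def)
    have comp: "?r x y \<or> ?r y x" if "x \<in> \<tau>" "y \<in> \<tau>" for x y
      using lecomp[OF that] by (auto simp: le_def)
    have pr: "\<tau> \<subseteq> proper" using sub by (auto simp: upper_part_def lower_part_def)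
    \<comment> \<open>If \<tau> misses \<open>mid\<close>, its members are \<open>low\<close> or
      \<open>high\<close>. The greatest \<open>low\<close> and the least \<open>high\<close> member
      are related by \<open>le\<close>, whose witness is comparable with all others. If one kind is
      absent, membership in \<open>upper_part\<close> or \<open>lower_part\<close> gives the
      witness.\<close>
    have "\<exists>z\<in>mid. \<forall>x\<in>\<tau>. ?r x z \<or> ?r z x"
    proof (cases "\<tau> \<inter> mid = {}")
      case False
      then show ?thesis using comp by blast
    next
      case True
      let ?Lo = "{x\<in>\<tau>. low x}" and ?Hi = "{x\<in>\<tau>. high x}"
      have split: "x \<in> ?Lo \<or> x \<in> ?Hi" if "x \<in> \<tau>" for x
      proof -
        have "x \<in> tame" using that pr proper_tame by blast
        then show ?thesis using that True by (cases rule: tame_cases) auto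
      qed
      have top: "\<exists>x\<in>?Lo. \<forall>y\<in>?Lo. ?r y x" if "?Lo \<noteq> {}"
        by (rule refines_chain_greatest) (use that fin comp in auto)
      have bot: "\<exists>x\<in>?Hi. \<forall>y\<in>?Hi. ?r x y" if "?Hi \<noteq> {}"
        by (rule refines_chain_least) (use that fin comp in auto)
      consider "?Lo = {}" "?Hi \<noteq> {}" | "?Lo \<noteq> {}" "?Hi = {}" | "?Lo \<noteq> {}" "?Hi \<noteq> {}"
        using ne split by blast
      then show ?thesis
      proof cases
        case 1
        then obtain y where y: "y \<in> \<tau>" "high y" "\<forall>x\<in>?Hi. ?r y x" using bot by auto
        then have "y \<in> upper_part" using sub low_not_high by (auto simp: lower_part_def proper_def)
        then obtain z where z: "z \<in> mid" "?r z y" by (auto simp: upper_part_def)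
        have "?r z x" if "x \<in> \<tau>" for x
          using split[OF that] 1 y(3) that refines_trans[OF z(2)] by blast
        then show ?thesis using z by blast
      next
        case 2
        then obtain x where x: "x \<in> \<tau>" "low x" "\<forall>y\<in>?Lo. ?r y x" using top by auto
        then have "x \<in> lower_part" using sub upper_not_low by auto
        then obtain z where z: "z \<in> mid" "?r x z" by (auto simp: lower_part_def)
        have "?r w z" if "w \<in> \<tau>" for w
          using split[OF that] 2 x(3) that refines_trans[OF _ z(2)] by blast
        then show ?thesis using z by blast
      next
        case 3
        then obtain x y where x: "x \<in> \<tau>" "low x" "\<forall>w\<in>?Lo. ?r w x"
          and y: "y \<in> \<tau>" "high y" "\<forall>w\<in>?Hi. ?r y w" using top bot by auto
        have "\<not> ?r y x" using refines_high[of y x] y x pr low_not_high proper_tame by blast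
        then have "le x y" using lecomp[OF x(1) y(1)] by (auto simp: le_def)
        then obtain z where z: "z \<in> mid" "?r x z" "?r z y" using x y by (auto simp: le_def)
        have "?r w z \<or> ?r z w" if "w \<in> \<tau>" for w
          using split[OF that] x(3) y(3) that refines_trans[OF _ z(2)] refines_trans[OF z(3)] by blast
        then show ?thesis using z by blast
      qed
    qed
    then obtain z where z: "z \<in> mid" "\<And>x. x \<in> \<tau> \<Longrightarrow> ?r x z \<or> ?r z x" by blast
    define F where "F = {C. C \<subseteq> proper \<and> (\<forall>x\<in>C. \<forall>y\<in>C. ?r x y \<or> ?r y x)}"
    have finp: "finite proper" 
      using finite_nc_partitions[of m] tame_nc proper_tame by (meson finite_subset subsetI)
    then have finF: "finite F" unfolding F_def by (auto intro: finite_subset[of _ "Pow proper"])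
    have "insert z \<tau> \<in> F"
      using z pr comp mid_proper rr mid_tame unfolding F_def by blast
    then obtain C where C: "C \<in> F" "insert z \<tau> \<subseteq> C" and Cmax: "\<And>D. D \<in> F \<Longrightarrow> C \<subseteq> D \<Longrightarrow> C = D"
      using finite_has_maximal2[OF finF] by metis
    have Cp: "C \<subseteq> proper" and Ccomp: "\<And>x y. x \<in> C \<Longrightarrow> y \<in> C \<Longrightarrow> ?r x y \<or> ?r y x"
      using C(1) by (auto simp: F_def)
    have Ctame: "C \<subseteq> tame" using Cp proper_tame by blast
    have "C \<in> link"
      using Cp Ccomp C(2) finite_subset[OF Cp finp] tame_nc
      unfolding link order_complex_def proper_def by auto
    moreover have "\<rho> = C" if \<rho>: "\<rho> \<in> link" "C \<subseteq> \<rho>" for \<rho>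
    proof (rule ccontr)
      assume "\<rho> \<noteq> C"
      then obtain \<pi> where \<pi>: "\<pi> \<in> \<rho>" "\<pi> \<notin> C" using \<rho> by blast
      have \<rho>': "\<rho> \<subseteq> nc_partitions m - {NC_min m, NC_max m}" "\<And>x y. x \<in> \<rho> \<Longrightarrow> y \<in> \<rho> \<Longrightarrow> ?r x y \<or> ?r y x"
        using \<rho>(1) by (auto simp: link order_complex_def)
      have \<pi>nc: "\<pi> \<in> nc_partitions m" using \<pi> \<rho>' by blast
      let ?C = "C \<union> {NC_min m, NC_max m}"
      have \<pi>C: "\<pi> \<notin> ?C" using \<pi> \<rho>' by blast
      have Ct: "?C \<subseteq> tame" using Ctame NC_min_tame NC_max_tame by blast
      have Cfin: "finite ?C" using finite_subset[OF Cp finp] by simp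
      have Cc: "?r x y \<or> ?r y x" if "x \<in> ?C" "y \<in> ?C" for x y
      proof -
        have "x \<in> nc_partitions m" "y \<in> nc_partitions m" using that Ct tame_nc by blast+
        then show ?thesis using that Ccomp NC_min_refines refines_NC_max[OF m1(1)] by blast
      qed
      have c\<pi>: "?r c \<pi> \<or> ?r \<pi> c" if "c \<in> ?C" for c
        using that \<rho>'(2)[of c \<pi>] \<rho>(2) \<pi>(1) NC_min_refines[OF \<pi>nc] refines_NC_max[OF m1(1) \<pi>nc] by blast
      \<comment> \<open>The neighbours \<open>x\<close> and \<open>y\<close> of \<open>\<pi>\<close>
        in the chain are sought; adding the two trivial partitions guarantees that both exist. A
        tame partition between \<open>x\<close> and \<open>y\<close> will contradict the choice of
        \<open>C\<close>, although \<open>\<pi>\<close> itself may fail to be tame.\<close>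
      let ?D = "{c\<in>?C. ?r c \<pi>}" and ?E = "{c\<in>?C. ?r \<pi> c}"
      have "NC_min m \<in> ?D" "NC_max m \<in> ?E" using NC_min_refines[OF \<pi>nc] refines_NC_max[OF m1(1) \<pi>nc] by auto
      then have "?D \<noteq> {}" "?E \<noteq> {}" by blast+
      have "\<exists>x\<in>?D. \<forall>y\<in>?D. ?r y x"
        by (rule refines_chain_greatest) (use \<open>?D \<noteq> {}\<close> Cfin Cc in auto)
      then obtain x where x: "x \<in> ?C" "?r x \<pi>" "\<And>c. c \<in> ?D \<Longrightarrow> ?r c x" by blast
      have "\<exists>x\<in>?E. \<forall>y\<in>?E. ?r x y"
        by (rule refines_chain_least) (use \<open>?E \<noteq> {}\<close> Cfin Cc in auto)
      then obtain y where y: "y \<in> ?C" "?r \<pi> y" "\<And>c. c \<in> ?E \<Longrightarrow> ?r y c" by blast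
      have xyt: "x \<in> tame" "y \<in> tame" using x y Ct by blast+
      have xy: "?r x y" using refines_trans[OF x(2) y(2)] .
      have x\<pi>: "x \<noteq> \<pi>" and \<pi>y: "\<pi> \<noteq> y" using x y \<pi>C by auto
      have mx: "maxs \<pi> \<subset> maxs x" using maxs_strict[OF tame_nc[OF xyt(1)] \<pi>nc x(2) x\<pi>] .
      have my: "maxs y \<subset> maxs \<pi>" using maxs_strict[OF \<pi>nc tame_nc[OF xyt(2)] y(2) \<pi>y] .
      have "x \<noteq> y" using mx my by blast
      then obtain B R w where w: "merges x B R w" "w \<in> nc_partitions m" "?r x w" "?r w y"
          "\<exists>Y\<in>y. Max Y = Max R \<and> R \<union> B \<subseteq> Y"
        using merge_exists[OF tame_nc[OF xyt(1)] tame_nc[OF xyt(2)] xy] by metis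
      note wm = merge_maxs[OF tame_nc[OF xyt(1)] w(1)]
      have wt: "w \<in> tame" using w(5) merge_tame[OF xyt w(1,2)] by blast
      have "w \<noteq> x" using wm by blast
      \<comment> \<open>A merge removes one maximum, whereas passing from \<open>x\<close> through
        \<open>\<pi>\<close> to \<open>y\<close> removes at least two.\<close>
      have "w \<noteq> y" using wm mx my by blast
      have side: "(?r c x \<and> ?r c w) \<or> (?r y c \<and> ?r w c)" if "c \<in> ?C" for c
        using c\<pi>[OF that] x(3)[of c] y(3)[of c] that w(3,4) refines_trans by blast
      have wC: "w \<notin> ?C"
        using side[of w] \<open>w \<noteq> x\<close> \<open>w \<noteq> y\<close> w(3,4) refines_asym by blast
      have "insert w C \<in> F"
        using wC wt Cp Ccomp side rr[OF wt] unfolding F_def proper_def by blast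
      then show False using Cmax[of "insert w C"] wC by blast
    qed
    ultimately have max: "C \<in> maximal_simplices link" by (auto simp: maximal_simplices_def)
    then have "simplex_label m C \<in> PF (m - 1) k" using label Ctame C(2) z(1) by blast
    then show "\<tau> \<in> ?K" using max ne C(2) by (auto simp: with_faces_def)
  qed
qed

end

theorem theorem3:
  fixes n k :: nat and P :: "nat \<Rightarrow> real^2"
  assumes "convex_polygon (n + 1) P"
    and "1 < k" and "k \<le> n"
  defines "K \<equiv> with_faces {\<sigma> \<in> maximal_simplices (NC_link (n + 1) P). simplex_label (n + 1) \<sigma> \<in> PF n k}"
  shows "subcomplex K (NC_link (n + 1) P) \<and> contractible_complex K"
proof -
  interpret parking_space "n + 1" k
    using assms by unfold_locales auto
  have link: "NC_link (n + 1) P =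
      order_complex (nc_partitions (n + 1) - {NC_min (n + 1), NC_max (n + 1)}) (refines {1..n + 1})"
    unfolding NC_link_def NC_eq[OF assms(1)] nc_partitions_def ..
  have K: "K = order_complex (upper_part \<union> lower_part) le"
    unfolding K_def using with_faces_eq[OF link] by simp
  have "K \<subseteq> NC_link (n + 1) P"
  proof
    fix \<tau> assume "\<tau> \<in> K"
    then obtain \<sigma> where "\<sigma> \<in> NC_link (n + 1) P" "\<tau> \<noteq> {}" "\<tau> \<subseteq> \<sigma>"
      by (auto simp: K_def with_faces_def maximal_simplices_def)
    then show "\<tau> \<in> NC_link (n + 1) P"
      using abstract_complex_face[OF abstract_complex_order_complex] unfolding NC_link_def by blast
  qed
  then show ?thesis
    using contractible_chains abstract_complex_order_complex unfolding subcomplex_def K by blast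
qed

end
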